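(* Let $\Bbbk$ be an algebraically closed field and $\mathscr{C}$ a locally-finite, pivotal, abelian, tensor $\Bbbk$-category. Let $P$ be the projective cover of a simple object in $\mathscr{C}$, let $(P,\alpha,\beta,\eta,\epsilon)$ be the corresponding trace tuple with $\alpha$ and $\beta$ simple (so that $\Proj\subseteq I_\alpha^\beta$, where $\Proj=\mathcal{P}roj(\mathscr{C})$ is the class of projective objects of $\mathscr{C}$), and let $\mathsf{t}$ be the associated right $(\alpha,\beta)$-trace on $I_\alpha^\beta$. Then for any projective object $Q\in\mathcal{P}roj(\mathscr{C})\subseteq I_\alpha^\beta$ and any $V\in\mathscr{C}$ the map $$\operatorname{Hom}_{\mathscr{C}}(V,\beta\otimes Q)\times\operatorname{Hom}_{\mathscr{C}}(\alpha\otimes Q,V)\to\Bbbk,\qquad (g,f)\mapsto\mathsf{t}_Q(gf),$$ is a non-degenerate pairing.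
   Context: Composition of morphisms is written $fg=f\circ g$. A pivotal tensor $\Bbbk$-category is a strict monoidal category $\mathscr{C}$ that is additive, with hom-sets $\Bbbk$-modules and with $\Bbbk$-bilinear composition and tensor product, such that $\Bbbk\to\operatorname{End}_{\mathscr{C}}(\mathbf{1})$, $k\mapsto k\operatorname{Id}_{\mathbf 1}$, is an isomorphism ($\mathbf 1$ is the unit object), and such that each object $V$ has a dual $V^*$ with morphisms $\operatorname{coev}_V:\mathbf 1\to V\otimes V^*$, $\operatorname{ev}_V:V^*\otimes V\to\mathbf 1$ and $\widetilde{\operatorname{coev}}_V:\mathbf 1\to V^*\otimes V$, $\widetilde{\operatorname{ev}}_V:V\otimes V^*\to\mathbf 1$ satisfying the zig-zag identities (left and right duality), for which the left and right duals of each morphism coincide and the two canonical isomorphisms $W^*\otimes V^*\to (V\otimes W)^*$ coincide (these are taken to be identities). Locally-finite: every $\operatorname{Hom}_{\mathscr{C}}(X,Y)$ has finite length over $\Bbbk$ and every object has finite length. Right ideal: a full subcategory $I$ closed under $V\mapsto V\otimes W$ for all $W\in\mathscr{C}$ and under retracts. Right partial trace: for $g\in\operatorname{Hom}_{\mathscr{C}}(V\otimes W,X\otimes W)$, $\operatorname{tr}_r^W(g)=(\operatorname{Id}_X\otimes\widetilde{\operatorname{ev}}_W)(g\otimes\operatorname{Id}_{W^*})(\operatorname{Id}_V\otimes\operatorname{coev}_W)$. Right $(\alpha,\beta)$-trace on $I$: a family of $\Bbbk$-linear maps $\mathsf{t}_V:\operatorname{Hom}_{\mathscr{C}}(\alpha\otimes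 V,\beta\otimes V)\to\Bbbk$, $V\in I$, with (1) $\mathsf{t}_{U\otimes W}(f)=\mathsf{t}_U(\operatorname{tr}_r^W(f))$ for $U\in I$, $W\in\mathscr{C}$, $f:\alpha\otimes U\otimes W\to\beta\otimes U\otimes W$; (2) $\mathsf{t}_V((\operatorname{Id}_\beta\otimes g)f)=\mathsf{t}_U(f(\operatorname{Id}_\alpha\otimes g))$ for $U,V\in I$, $f:\alpha\otimes V\to\beta\otimes U$, $g:U\to V$. Trace tuple: $(P,\alpha,\beta,\eta,\epsilon)$ with $\eta:\alpha\to P$, $\epsilon:P\to\beta$ nonzero such that $\operatorname{End}_{\mathscr{C}}(P)/\operatorname{J}(\operatorname{End}_{\mathscr{C}}(P))\cong\Bbbk$ with the Jacobson radical $\operatorname{J}(\operatorname{End}_{\mathscr{C}}(P))$ nilpotent, and $\operatorname{Hom}_{\mathscr{C}}(\alpha,P)=\Bbbk\eta$, $\operatorname{Hom}_{\mathscr{C}}(P,\beta)=\Bbbk\epsilon$ (free of rank one). When $P$ is the projective cover of a simple object, $P$ has a unique simple quotient $\beta$ and a unique simple subobject $\alpha$ (the socle); the corresponding trace tuple is given by these together with a projection $\epsilon:P\to\beta$ and an inclusion $\eta:\alpha\to P$. For a trace tuple, $I_\alpha^\beta$ is the right ideal of objects $V$ for which there exist $\sigma_V:P\otimes V\to\alpha\otimes V$ with $\sigma_V(\eta\otimes\operatorname{Id}_V)=\operatorname{Id}_{\alpha\otimes V}$ and $\tau_V:\beta\otimes V\to P\otimes V$ with $(\epsilon\otimes\operatorname{Id}_V)\tau_V=\operatorname{Id}_{\beta\otimes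 V}$. For $g\in\operatorname{Hom}_{\mathscr{C}}(\alpha,P)$, $h\in\operatorname{Hom}_{\mathscr{C}}(P,\beta)$ write $g=\langle g\rangle_\eta\eta$, $h=\langle h\rangle_\epsilon\epsilon$. The associated right $(\alpha,\beta)$-trace on $I_\alpha^\beta$ is $\mathsf{t}_V(f)=\langle\operatorname{tr}_r^V(\tau_Vf)\rangle_\eta=\langle\operatorname{tr}_r^V(f\sigma_V)\rangle_\epsilon$, which is well defined independently of the choices of $\sigma_V,\tau_V$. *)

theory Defs
  imports "HOL-Algebra.Algebraic_Closure_Type"
begin

text \<open>Frees \<open>X\<close> for use as a variable.\<close>

no_notation Polynomials.var (\<open>X\<index>\<close>)


section \<open>Ring and module theory\<close>

text \<open>Rings below need not be commutative, so the Jacobson radical is defined through maximal left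
  ideals; the ideals of the library are two-sided.\<close>

definition left_ideal :: "'a set \<Rightarrow> ('a, 'b) ring_scheme \<Rightarrow> bool" where
  "left_ideal I R \<longleftrightarrow>
     subgroup I (add_monoid R) \<and> (\<forall>r\<in>carrier R. \<forall>x\<in>I. r \<otimes>\<^bsub>R\<^esub> x \<in> I)"

definition maximal_left_ideal :: "'a set \<Rightarrow> ('a, 'b) ring_scheme \<Rightarrow> bool" where
  "maximal_left_ideal I R \<longleftrightarrow> left_ideal I R \<and> I \<noteq> carrier R \<and>
     (\<forall>L. left_ideal L R \<and> I \<subseteq> L \<longrightarrow> L = I \<or> L = carrier R)"

definition jacobson_radical :: "('a, 'b) ring_scheme \<Rightarrow> 'a set" where
  "jacobson_radical R = {x \<in> carrier R. \<forall>I. maximal_left_ideal I R \<longrightarrow> x \<in> I}"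

text \<open>Some power of \<open>I\<close> vanishes: that power is additively spanned by the products of \<open>n\<close> elements
  of \<open>I\<close>.\<close>

definition nilpotent_ideal :: "'a set \<Rightarrow> ('a, 'b) ring_scheme \<Rightarrow> bool" where
  "nilpotent_ideal I R \<longleftrightarrow>
     (\<exists>n. \<forall>xs. length xs = n \<and> set xs \<subseteq> I \<longrightarrow>
        foldr (\<lambda>x y. x \<otimes>\<^bsub>R\<^esub> y) xs \<one>\<^bsub>R\<^esub> = \<zero>\<^bsub>R\<^esub>)"

text \<open>Submodules \<open>N\<close> admitting a composition series: each step adds a simple subquotient.\<close>

inductive finite_length_submodule ::
    "('r, 's) ring_scheme \<Rightarrow> ('r, 'a, 't) module_scheme \<Rightarrow> 'a set \<Rightarrow> bool" for R M where
  zero: "finite_length_submodule R M {\<zero>\<^bsub>M\<^esub>}"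
| step: "finite_length_submodule R M N \<Longrightarrow> submodule N' R M \<Longrightarrow> N \<subset> N' \<Longrightarrow>
    (\<And>L. submodule L R M \<Longrightarrow> N \<subseteq> L \<Longrightarrow> L \<subseteq> N' \<Longrightarrow> L = N \<or> L = N') \<Longrightarrow>
    finite_length_submodule R M N'"

definition finite_length_module ::
    "('r, 's) ring_scheme \<Rightarrow> ('r, 'a, 't) module_scheme \<Rightarrow> bool" where
  "finite_length_module R M \<longleftrightarrow> finite_length_submodule R M (carrier M)"

definition linear_form :: "('k::comm_ring_1, 'a, 't) module_scheme \<Rightarrow> ('a \<Rightarrow> 'k) \<Rightarrow> bool" where
  "linear_form M \<phi> \<longleftrightarrow>
     (\<forall>x\<in>carrier M. \<forall>y\<in>carrier M. \<phi> (x \<oplus>\<^bsub>M\<^esub> y) = \<phi> x + \<phi> y) \<and>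
     (\<forall>c. \<forall>x\<in>carrier M. \<phi> (c \<odot>\<^bsub>M\<^esub> x) = c * \<phi> x)"

definition nondegenerate_pairing ::
    "('k::comm_ring_1, 'a, 't) module_scheme \<Rightarrow> ('k, 'b, 'u) module_scheme \<Rightarrow>
     ('a \<Rightarrow> 'b \<Rightarrow> 'k) \<Rightarrow> bool" where
  "nondegenerate_pairing M N b \<longleftrightarrow>
     (\<forall>y\<in>carrier N. linear_form M (\<lambda>x. b x y)) \<and>
     (\<forall>x\<in>carrier M. linear_form N (b x)) \<and>
     (\<forall>x\<in>carrier M. (\<forall>y\<in>carrier N. b x y = 0) \<longrightarrow> x = \<zero>\<^bsub>M\<^esub>) \<and>
     (\<forall>y\<in>carrier N. (\<forall>x\<in>carrier M. b x y = 0) \<longrightarrow> y = \<zero>\<^bsub>N\<^esub>)"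


section \<open>Pivotal tensor categories\<close>

text \<open>Every element of \<open>'o\<close> is an object and every element of \<open>'m\<close> is a morphism. The composite
  \<open>g \<cdot> f\<close> means \<open>f\<close> first, then \<open>g\<close>, and is only meaningful when the target of \<open>f\<close> is the source
  of \<open>g\<close>; likewise addition is only meaningful for parallel morphisms. The last two fields are the
  evaluation and coevaluation written with a tilde in the literature.\<close>

record ('o, 'm, 'k) tensor_data =
  src :: "'m \<Rightarrow> 'o"
  tgt :: "'m \<Rightarrow> 'o"
  idm :: "'o \<Rightarrow> 'm" (\<open>\<iota>\<index>\<close>)
  comp :: "'m \<Rightarrow> 'm \<Rightarrow> 'm" (infixl \<open>\<cdot>\<index>\<close> 70)
  zerom :: "'o \<Rightarrow> 'o \<Rightarrow> 'm" (\<open>\<zero>\<^sub>m\<index>\<close>)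
  addm :: "'m \<Rightarrow> 'm \<Rightarrow> 'm" (infixl \<open>\<oplus>\<^sub>m\<index>\<close> 65)
  scalem :: "'k \<Rightarrow> 'm \<Rightarrow> 'm" (infixr \<open>\<odot>\<^sub>m\<index>\<close> 75)
  tensor_obj :: "'o \<Rightarrow> 'o \<Rightarrow> 'o" (infixr \<open>\<boxtimes>\<index>\<close> 80)
  tensor_mor :: "'m \<Rightarrow> 'm \<Rightarrow> 'm" (infixr \<open>\<boxtimes>\<^sub>m\<index>\<close> 80)
  unit_obj :: 'o (\<open>\<bbbone>\<index>\<close>)
  dual :: "'o \<Rightarrow> 'o" (\<open>_\<^sup>\<star>\<index>\<close> [1000] 999)
  ev_mor :: "'o \<Rightarrow> 'm" (\<open>ev\<index>\<close>)
  coev_mor :: "'o \<Rightarrow> 'm" (\<open>coev\<index>\<close>)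
  evt_mor :: "'o \<Rightarrow> 'm" (\<open>evt\<index>\<close>)
  coevt_mor :: "'o \<Rightarrow> 'm" (\<open>coevt\<index>\<close>)

abbreviation scalars :: "'k::comm_ring_1 ring" where
  "scalars \<equiv> ring_of_type_algebra"

context
  fixes C :: "('o, 'm, 'k::comm_ring_1) tensor_data" (structure)
begin

definition Hom :: "'o \<Rightarrow> 'o \<Rightarrow> 'm set" where
  "Hom X Y = {f. src C f = X \<and> tgt C f = Y}"

text \<open>The hom-set as a module over the scalars. For \<open>X = Y\<close> this is also the endomorphism ring of
  \<open>X\<close>; for \<open>X \<noteq> Y\<close> the multiplicative fields carry no meaning.\<close>

definition Hom_module :: "'o \<Rightarrow> 'o \<Rightarrow> ('k, 'm) module" where
  "Hom_module X Y =
     \<lparr>carrier = Hom X Y, monoid.mult = (\<lambda>f g. f \<cdot> g), one = \<iota> X,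
      ring.zero = \<zero>\<^sub>m X Y, add = (\<lambda>f g. f \<oplus>\<^sub>m g), module.smult = (\<lambda>c f. c \<odot>\<^sub>m f)\<rparr>"

definition monic :: "'m \<Rightarrow> bool" where
  "monic f \<longleftrightarrow> (\<forall>Z. \<forall>g\<in>Hom Z (src C f). \<forall>h\<in>Hom Z (src C f). f \<cdot> g = f \<cdot> h \<longrightarrow> g = h)"

definition epic :: "'m \<Rightarrow> bool" where
  "epic f \<longleftrightarrow> (\<forall>Z. \<forall>g\<in>Hom (tgt C f) Z. \<forall>h\<in>Hom (tgt C f) Z. g \<cdot> f = h \<cdot> f \<longrightarrow> g = h)"

definition isomorphism :: "'m \<Rightarrow> bool" where
  "isomorphism f \<longleftrightarrow> (\<exists>g\<in>Hom (tgt C f) (src C f). g \<cdot> f = \<iota> (src C f) \<and> f \<cdot> g = \<iota> (tgt C f))"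

definition zero_object :: "'o \<Rightarrow> bool" where
  "zero_object Z \<longleftrightarrow> (\<forall>X. (\<exists>!f. f \<in> Hom Z X) \<and> (\<exists>!f. f \<in> Hom X Z))"

definition biproduct :: "'o \<Rightarrow> 'o \<Rightarrow> 'o \<Rightarrow> bool" where
  "biproduct X Y B \<longleftrightarrow>
     (\<exists>i\<in>Hom X B. \<exists>j\<in>Hom Y B. \<exists>p\<in>Hom B X. \<exists>q\<in>Hom B Y.
        p \<cdot> i = \<iota> X \<and> q \<cdot> j = \<iota> Y \<and> q \<cdot> i = \<zero>\<^sub>m X Y \<and> p \<cdot> j = \<zero>\<^sub>m Y X \<and>
        (i \<cdot> p) \<oplus>\<^sub>m (j \<cdot> q) = \<iota> B)"

definition kernel_of :: "'m \<Rightarrow> 'm \<Rightarrow> bool" where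
  "kernel_of f k \<longleftrightarrow>
     tgt C k = src C f \<and> f \<cdot> k = \<zero>\<^sub>m (src C k) (tgt C f) \<and>
     (\<forall>Z. \<forall>h\<in>Hom Z (src C f). f \<cdot> h = \<zero>\<^sub>m Z (tgt C f) \<longrightarrow>
        (\<exists>!u. u \<in> Hom Z (src C k) \<and> k \<cdot> u = h))"

definition cokernel_of :: "'m \<Rightarrow> 'm \<Rightarrow> bool" where
  "cokernel_of f c \<longleftrightarrow>
     src C c = tgt C f \<and> c \<cdot> f = \<zero>\<^sub>m (src C f) (tgt C c) \<and>
     (\<forall>Z. \<forall>h\<in>Hom (tgt C f) Z. h \<cdot> f = \<zero>\<^sub>m (src C f) Z \<longrightarrow>
        (\<exists>!u. u \<in> Hom (tgt C c) Z \<and> u \<cdot> c = h))"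

text \<open>To be used for additive categories.\<close>

definition abelian_category :: bool where
  "abelian_category \<longleftrightarrow>
     (\<forall>f. \<exists>k. kernel_of f k) \<and> (\<forall>f. \<exists>c. cokernel_of f c) \<and>
     (\<forall>f. monic f \<longrightarrow> (\<exists>g. kernel_of g f)) \<and> (\<forall>f. epic f \<longrightarrow> (\<exists>g. cokernel_of g f))"

definition simple_object :: "'o \<Rightarrow> bool" where
  "simple_object S \<longleftrightarrow> \<not> zero_object S \<and>
     (\<forall>X. \<forall>i\<in>Hom X S. monic i \<longrightarrow> zero_object X \<or> isomorphism i)"

text \<open>Existence of a composition series: \<open>0 \<rightarrow> Y \<rightarrow> X \<rightarrow> S \<rightarrow> 0\<close> is short exact in the second clause.\<close>

inductive finite_length_object :: "'o \<Rightarrow> bool" where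
  zero: "zero_object X \<Longrightarrow> finite_length_object X"
| extension: "finite_length_object Y \<Longrightarrow> simple_object S \<Longrightarrow> i \<in> Hom Y X \<Longrightarrow> p \<in> Hom X S \<Longrightarrow>
    kernel_of p i \<Longrightarrow> cokernel_of i p \<Longrightarrow> finite_length_object X"

definition locally_finite :: bool where
  "locally_finite \<longleftrightarrow>
     (\<forall>X Y. finite_length_module scalars (Hom_module X Y)) \<and> (\<forall>X. finite_length_object X)"

definition projective :: "'o \<Rightarrow> bool" where
  "projective P \<longleftrightarrow>
     (\<forall>X Y. \<forall>e\<in>Hom X Y. \<forall>f\<in>Hom P Y. epic e \<longrightarrow> (\<exists>g\<in>Hom P X. e \<cdot> g = f))"

text \<open>\<open>p\<close> is an essential (superfluous) epimorphism from a projective object.\<close>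

definition projective_cover :: "'o \<Rightarrow> 'o \<Rightarrow> 'm \<Rightarrow> bool" where
  "projective_cover S P p \<longleftrightarrow> projective P \<and> p \<in> Hom P S \<and> epic p \<and>
     (\<forall>X. \<forall>g\<in>Hom X P. epic (p \<cdot> g) \<longrightarrow> epic g)"

text \<open>The left and the right dual \<open>W\<^sup>\<star> \<rightarrow> V\<^sup>\<star>\<close> of a morphism \<open>f: V \<rightarrow> W\<close>.\<close>

definition left_dual_mor :: "'m \<Rightarrow> 'm" where
  "left_dual_mor f =
     (let V = src C f; W = tgt C f in
       (ev W \<boxtimes>\<^sub>m \<iota> (V\<^sup>\<star>)) \<cdot> (\<iota> (W\<^sup>\<star>) \<boxtimes>\<^sub>m f \<boxtimes>\<^sub>m \<iota> (V\<^sup>\<star>)) \<cdot> (\<iota> (W\<^sup>\<star>) \<boxtimes>\<^sub>m coev V))"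

definition right_dual_mor :: "'m \<Rightarrow> 'm" where
  "right_dual_mor f =
     (let V = src C f; W = tgt C f in
       (\<iota> (V\<^sup>\<star>) \<boxtimes>\<^sub>m evt W) \<cdot> (\<iota> (V\<^sup>\<star>) \<boxtimes>\<^sub>m f \<boxtimes>\<^sub>m \<iota> (W\<^sup>\<star>)) \<cdot> (coevt V \<boxtimes>\<^sub>m \<iota> (W\<^sup>\<star>)))"

text \<open>The two canonical isomorphisms \<open>W\<^sup>\<star> \<boxtimes> V\<^sup>\<star> \<rightarrow> (V \<boxtimes> W)\<^sup>\<star>\<close>.\<close>

definition left_dual_tensor :: "'o \<Rightarrow> 'o \<Rightarrow> 'm" where
  "left_dual_tensor V W =
     (ev W \<boxtimes>\<^sub>m \<iota> ((V \<boxtimes> W)\<^sup>\<star>)) \<cdot>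
     (\<iota> (W\<^sup>\<star>) \<boxtimes>\<^sub>m ev V \<boxtimes>\<^sub>m \<iota> W \<boxtimes>\<^sub>m \<iota> ((V \<boxtimes> W)\<^sup>\<star>)) \<cdot>
     (\<iota> (W\<^sup>\<star>) \<boxtimes>\<^sub>m \<iota> (V\<^sup>\<star>) \<boxtimes>\<^sub>m coev (V \<boxtimes> W))"

definition right_dual_tensor :: "'o \<Rightarrow> 'o \<Rightarrow> 'm" where
  "right_dual_tensor V W =
     (\<iota> ((V \<boxtimes> W)\<^sup>\<star>) \<boxtimes>\<^sub>m evt V) \<cdot>
     (\<iota> ((V \<boxtimes> W)\<^sup>\<star>) \<boxtimes>\<^sub>m \<iota> V \<boxtimes>\<^sub>m evt W \<boxtimes>\<^sub>m \<iota> (V\<^sup>\<star>)) \<cdot>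
     (coevt (V \<boxtimes> W) \<boxtimes>\<^sub>m \<iota> (W\<^sup>\<star>) \<boxtimes>\<^sub>m \<iota> (V\<^sup>\<star>))"

end

locale linear_category =
  fixes C :: "('o, 'm, 'k::comm_ring_1) tensor_data" (structure)
  assumes id_in_Hom: "\<iota> X \<in> Hom C X X"
    and comp_in_Hom: "f \<in> Hom C X Y \<Longrightarrow> g \<in> Hom C Y Z \<Longrightarrow> g \<cdot> f \<in> Hom C X Z"
    and comp_id_left: "f \<in> Hom C X Y \<Longrightarrow> \<iota> Y \<cdot> f = f"
    and comp_id_right: "f \<in> Hom C X Y \<Longrightarrow> f \<cdot> \<iota> X = f"
    and comp_assoc: "f \<in> Hom C W X \<Longrightarrow> g \<in> Hom C X Y \<Longrightarrow> h \<in> Hom C Y Z \<Longrightarrow>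
      (h \<cdot> g) \<cdot> f = h \<cdot> (g \<cdot> f)"
    and Hom_module: "Module.module scalars (Hom_module C X Y)"
    and comp_add_left: "f \<in> Hom C X Y \<Longrightarrow> g \<in> Hom C Y Z \<Longrightarrow> h \<in> Hom C Y Z \<Longrightarrow>
      (g \<oplus>\<^sub>m h) \<cdot> f = g \<cdot> f \<oplus>\<^sub>m h \<cdot> f"
    and comp_add_right: "f \<in> Hom C X Y \<Longrightarrow> g \<in> Hom C X Y \<Longrightarrow> h \<in> Hom C Y Z \<Longrightarrow>
      h \<cdot> (f \<oplus>\<^sub>m g) = h \<cdot> f \<oplus>\<^sub>m h \<cdot> g"
    and comp_scale_left: "f \<in> Hom C X Y \<Longrightarrow> g \<in> Hom C Y Z \<Longrightarrow>
      (c \<odot>\<^sub>m g) \<cdot> f = c \<odot>\<^sub>m (g \<cdot> f)"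
    and comp_scale_right: "f \<in> Hom C X Y \<Longrightarrow> g \<in> Hom C Y Z \<Longrightarrow>
      g \<cdot> (c \<odot>\<^sub>m f) = c \<odot>\<^sub>m (g \<cdot> f)"

locale additive_category = linear_category +
  assumes zero_object_exists: "\<exists>Z. zero_object C Z"
    and biproduct_exists: "\<exists>B. biproduct C X Y B"

locale tensor_category = additive_category +
  assumes tensor_in_Hom: "f \<in> Hom C X Y \<Longrightarrow> g \<in> Hom C X' Y' \<Longrightarrow>
      f \<boxtimes>\<^sub>m g \<in> Hom C (X \<boxtimes> X') (Y \<boxtimes> Y')"
    and tensor_id: "\<iota> X \<boxtimes>\<^sub>m \<iota> Y = \<iota> (X \<boxtimes> Y)"
    and interchange: "f \<in> Hom C X Y \<Longrightarrow> g \<in> Hom C Y Z \<Longrightarrow> f' \<in> Hom C X' Y' \<Longrightarrow> g' \<in> Hom C Y' Z' \<Longrightarrow>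
      (g \<cdot> f) \<boxtimes>\<^sub>m (g' \<cdot> f') = (g \<boxtimes>\<^sub>m g') \<cdot> (f \<boxtimes>\<^sub>m f')"
    and tensor_obj_assoc: "(X \<boxtimes> Y) \<boxtimes> Z = X \<boxtimes> (Y \<boxtimes> Z)"
    and tensor_mor_assoc: "(f \<boxtimes>\<^sub>m g) \<boxtimes>\<^sub>m h = f \<boxtimes>\<^sub>m (g \<boxtimes>\<^sub>m h)"
    and unit_obj_left: "\<bbbone> \<boxtimes> X = X"
    and unit_obj_right: "X \<boxtimes> \<bbbone> = X"
    and unit_mor_left: "\<iota> \<bbbone> \<boxtimes>\<^sub>m f = f"
    and unit_mor_right: "f \<boxtimes>\<^sub>m \<iota> \<bbbone> = f"
    and tensor_add_left: "f \<in> Hom C X Y \<Longrightarrow> g \<in> Hom C X Y \<Longrightarrow>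
      (f \<oplus>\<^sub>m g) \<boxtimes>\<^sub>m h = f \<boxtimes>\<^sub>m h \<oplus>\<^sub>m g \<boxtimes>\<^sub>m h"
    and tensor_add_right: "f \<in> Hom C X Y \<Longrightarrow> g \<in> Hom C X Y \<Longrightarrow>
      h \<boxtimes>\<^sub>m (f \<oplus>\<^sub>m g) = h \<boxtimes>\<^sub>m f \<oplus>\<^sub>m h \<boxtimes>\<^sub>m g"
    and tensor_scale_left: "(c \<odot>\<^sub>m f) \<boxtimes>\<^sub>m g = c \<odot>\<^sub>m (f \<boxtimes>\<^sub>m g)"
    and tensor_scale_right: "f \<boxtimes>\<^sub>m (c \<odot>\<^sub>m g) = c \<odot>\<^sub>m (f \<boxtimes>\<^sub>m g)"
    and End_unit: "bij_betw (\<lambda>c. c \<odot>\<^sub>m \<iota> \<bbbone>) UNIV (Hom C \<bbbone> \<bbbone>)"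

locale pivotal_tensor_category = tensor_category +
  assumes ev_in_Hom: "ev V \<in> Hom C (V\<^sup>\<star> \<boxtimes> V) \<bbbone>"
    and coev_in_Hom: "coev V \<in> Hom C \<bbbone> (V \<boxtimes> V\<^sup>\<star>)"
    and evt_in_Hom: "evt V \<in> Hom C (V \<boxtimes> V\<^sup>\<star>) \<bbbone>"
    and coevt_in_Hom: "coevt V \<in> Hom C \<bbbone> (V\<^sup>\<star> \<boxtimes> V)"
    and zigzag: "(\<iota> V \<boxtimes>\<^sub>m ev V) \<cdot> (coev V \<boxtimes>\<^sub>m \<iota> V) = \<iota> V"
    and zigzag_dual: "(ev V \<boxtimes>\<^sub>m \<iota> (V\<^sup>\<star>)) \<cdot> (\<iota> (V\<^sup>\<star>) \<boxtimes>\<^sub>m coev V) = \<iota> (V\<^sup>\<star>)"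
    and zigzag_tilde: "(evt V \<boxtimes>\<^sub>m \<iota> V) \<cdot> (\<iota> V \<boxtimes>\<^sub>m coevt V) = \<iota> V"
    and zigzag_tilde_dual: "(\<iota> (V\<^sup>\<star>) \<boxtimes>\<^sub>m evt V) \<cdot> (coevt V \<boxtimes>\<^sub>m \<iota> (V\<^sup>\<star>)) = \<iota> (V\<^sup>\<star>)"
    and dual_mor_coincide: "left_dual_mor C f = right_dual_mor C f"
    and dual_tensor_coincide: "left_dual_tensor C V W = right_dual_tensor C V W"


section \<open>Partial traces and the trace of a trace tuple\<close>

context
  fixes C :: "('o, 'm, 'k::comm_ring_1) tensor_data" (structure)
begin

text \<open>\<open>right_partial_trace V X W g\<close> is \<open>tr\<^sub>r\<^sup>W(g): V \<rightarrow> X\<close> for \<open>g: V \<boxtimes> W \<rightarrow> X \<boxtimes> W\<close>. The objects \<open>V\<close> and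
  \<open>X\<close> have to be given, since \<open>V \<boxtimes> W\<close> does not determine \<open>V\<close>.\<close>

definition right_partial_trace :: "'o \<Rightarrow> 'o \<Rightarrow> 'o \<Rightarrow> 'm \<Rightarrow> 'm" where
  "right_partial_trace V X W g =
     (\<iota> X \<boxtimes>\<^sub>m evt W) \<cdot> (g \<boxtimes>\<^sub>m \<iota> (W\<^sup>\<star>)) \<cdot> (\<iota> V \<boxtimes>\<^sub>m coev W)"

text \<open>The quotient of the endomorphism ring by its radical is isomorphic to the ring of scalars as
  an algebra exactly when the unit map of that quotient is an isomorphism.\<close>

definition trace_tuple :: "'o \<Rightarrow> 'o \<Rightarrow> 'o \<Rightarrow> 'm \<Rightarrow> 'm \<Rightarrow> bool" where
  "trace_tuple P \<alpha> \<beta> \<eta> \<epsilon> \<longleftrightarrow>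
     \<eta> \<in> Hom C \<alpha> P \<and> \<eta> \<noteq> \<zero>\<^sub>m \<alpha> P \<and> \<epsilon> \<in> Hom C P \<beta> \<and> \<epsilon> \<noteq> \<zero>\<^sub>m P \<beta> \<and>
     (let E = Hom_module C P P; J = jacobson_radical E in
        (\<lambda>c. J +>\<^bsub>E\<^esub> (c \<odot>\<^sub>m \<iota> P)) \<in> ring_iso scalars (E Quot J) \<and> nilpotent_ideal J E) \<and>
     (\<forall>g\<in>Hom C \<alpha> P. \<exists>!c. g = c \<odot>\<^sub>m \<eta>) \<and>
     (\<forall>h\<in>Hom C P \<beta>. \<exists>!c. h = c \<odot>\<^sub>m \<epsilon>)"

definition left_inverse_at :: "'o \<Rightarrow> 'o \<Rightarrow> 'm \<Rightarrow> 'o \<Rightarrow> 'm \<Rightarrow> bool" where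
  "left_inverse_at P \<alpha> \<eta> V \<sigma> \<longleftrightarrow>
     \<sigma> \<in> Hom C (P \<boxtimes> V) (\<alpha> \<boxtimes> V) \<and> \<sigma> \<cdot> (\<eta> \<boxtimes>\<^sub>m \<iota> V) = \<iota> (\<alpha> \<boxtimes> V)"

definition right_inverse_at :: "'o \<Rightarrow> 'o \<Rightarrow> 'm \<Rightarrow> 'o \<Rightarrow> 'm \<Rightarrow> bool" where
  "right_inverse_at P \<beta> \<epsilon> V \<tau> \<longleftrightarrow>
     \<tau> \<in> Hom C (\<beta> \<boxtimes> V) (P \<boxtimes> V) \<and> (\<epsilon> \<boxtimes>\<^sub>m \<iota> V) \<cdot> \<tau> = \<iota> (\<beta> \<boxtimes> V)"

text \<open>The ideal \<open>I\<^sub>\<alpha>\<^sup>\<beta>\<close>, given by its class of objects.\<close>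

definition trace_ideal :: "'o \<Rightarrow> 'o \<Rightarrow> 'o \<Rightarrow> 'm \<Rightarrow> 'm \<Rightarrow> 'o set" where
  "trace_ideal P \<alpha> \<beta> \<eta> \<epsilon> =
     {V. (\<exists>\<sigma>. left_inverse_at P \<alpha> \<eta> V \<sigma>) \<and> (\<exists>\<tau>. right_inverse_at P \<beta> \<epsilon> V \<tau>)}"

text \<open>The scalar \<open>\<langle>g\<rangle>\<^sub>\<eta>\<close> with \<open>g = \<langle>g\<rangle>\<^sub>\<eta> \<eta>\<close>.\<close>

definition coefficient :: "'m \<Rightarrow> 'm \<Rightarrow> 'k" where
  "coefficient \<eta> g = (THE c. g = c \<odot>\<^sub>m \<eta>)"

text \<open>The common value of \<open>\<langle>tr\<^sub>r\<^sup>V(\<tau>\<^sub>V f)\<rangle>\<^sub>\<eta>\<close> and \<open>\<langle>tr\<^sub>r\<^sup>V(f \<sigma>\<^sub>V)\<rangle>\<^sub>\<epsilon>\<close> over all choices of \<open>\<sigma>\<^sub>V\<close> and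
  \<open>\<tau>\<^sub>V\<close>, for \<open>f: \<alpha> \<boxtimes> V \<rightarrow> \<beta> \<boxtimes> V\<close> and \<open>V\<close> in the ideal.\<close>

definition associated_trace :: "'o \<Rightarrow> 'o \<Rightarrow> 'o \<Rightarrow> 'm \<Rightarrow> 'm \<Rightarrow> 'o \<Rightarrow> 'm \<Rightarrow> 'k" where
  "associated_trace P \<alpha> \<beta> \<eta> \<epsilon> V f =
     (THE t. \<forall>\<sigma> \<tau>. left_inverse_at P \<alpha> \<eta> V \<sigma> \<and> right_inverse_at P \<beta> \<epsilon> V \<tau> \<longrightarrow>
        t = coefficient \<eta> (right_partial_trace \<alpha> P V (\<tau> \<cdot> f)) \<and>
        t = coefficient \<epsilon> (right_partial_trace P \<beta> V (f \<cdot> \<sigma>)))"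

end

end

theory Submission
  imports Defs
begin

text \<open>The argument combines the structure of the endomorphism ring of \<open>P\<close> with a description of the partial
  trace by transposes.

  The ring is local: its radical \<open>J\<close> consists of the endomorphisms killed by the cover, because every
  other endomorphism is epic and splits (\<open>local_End\<close>). Over an algebraically closed field, finite
  length makes \<open>J\<close> nilpotent and every endomorphism a scalar modulo \<open>J\<close> (\<open>nilpotent\<close>,
  \<open>exists_scalar_mod_J\<close>). Moreover \<open>\<epsilon> J = 0\<close> and \<open>J \<eta> = 0\<close>: as \<open>P\<close> is projective and
  also injective (\<open>projective_imp_injective\<close>), \<open>\<epsilon>\<close> would lift along a nonzero \<open>\<epsilon> j\<close> and \<open>\<eta>\<close> would extend
  along a nonzero \<open>j \<eta>\<close>, against the invertibility of \<open>1 - j x\<close> and \<open>1 - x j\<close>. So each endomorphism \<open>e\<close> of \<open>P\<close> has one scalar \<open>c\<close> with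
  \<open>\<epsilon> e = c \<epsilon>\<close> and \<open>e \<eta> = c \<eta>\<close> (\<open>End_acts_by_scalar\<close>). From this follow the trace tuple and, applied to
  \<open>e = tr (\<tau> f \<sigma>)\<close>, the equality of the two formulas for the trace of \<open>f\<close>.

  Injectivity is obtained without dualising morphisms: for projective \<open>Q\<close> and monic \<open>i\<close> with cokernel
  \<open>c\<close>, the epimorphism \<open>c \<boxtimes> Q\<close> has a projective target and splits, and therefore so does its kernel
  \<open>i \<boxtimes> Q\<close> (\<open>monic_tensor_projective_splits\<close>). The same lemma provides \<open>\<sigma>\<close>.

  For non-degeneracy, \<open>tr (g f)\<close> is the composite of a transpose \<open>\<alpha> \<rightarrow> V \<boxtimes> Q\<^sup>\<star>\<close> of \<open>f\<close> and a transpose of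
  \<open>g\<close> starting at \<open>V \<boxtimes> Q\<^sup>\<star>\<close> (\<open>partial_trace_comp\<close>). If \<open>f \<noteq> 0\<close>, the former is monic because \<open>\<alpha>\<close> is simple,
  and \<open>\<eta>\<close> extends along it to \<open>V \<boxtimes> Q\<^sup>\<star>\<close>; transposing back yields \<open>g'\<close> with values in \<open>P \<boxtimes> Q\<close> and
  \<open>tr (g' f) = \<eta>\<close>. Then \<open>tr (g' f \<sigma>)\<close> has scalar \<open>1\<close>, which means that \<open>(\<epsilon> \<boxtimes> Q) g'\<close> pairs with \<open>f\<close> to
  \<open>1\<close>. The argument for \<open>g \<noteq> 0\<close> is dual.\<close>


section \<open>Local rings\<close>

text \<open>The endomorphism ring of a projective cover \<open>p\<close> is met in the following form: the set \<open>J\<close> of the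
  endomorphisms killed by \<open>p\<close> is visibly a right ideal, and an endomorphism outside \<open>J\<close> splits. So the
  axioms only speak of one side, and the left-right symmetry is a consequence.\<close>

locale local_ring = ring R for R (structure) +
  fixes J :: "'a set"
  assumes subgroup: "subgroup J (add_monoid R)"
    and right_closed: "x \<in> J \<Longrightarrow> r \<in> carrier R \<Longrightarrow> x \<otimes> r \<in> J"
    and one_notin: "\<one> \<notin> J"
    and right_inverse: "r \<in> carrier R \<Longrightarrow> r \<notin> J \<Longrightarrow> \<exists>s\<in>carrier R. r \<otimes> s = \<one>"
begin

lemma in_carrier: "x \<in> J \<Longrightarrow> x \<in> carrier R"
  using subgroup.subset[OF subgroup] by auto

lemma zero_in: "\<zero> \<in> J"
  using subgroup.one_closed[OF subgroup] by simp

lemma minus_in: "x \<in> J \<Longrightarrow> \<ominus> x \<in> J"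
  using subgroup.m_inv_closed[OF subgroup] by (simp add: a_inv_def)

lemma add_in: "x \<in> J \<Longrightarrow> y \<in> J \<Longrightarrow> x \<oplus> y \<in> J"
  using subgroup.m_closed[OF subgroup] by simp

lemma one_minus_right_inverse:
  assumes "x \<in> J"
  shows "\<exists>t\<in>carrier R. (\<one> \<ominus> x) \<otimes> t = \<one>"
proof (rule right_inverse)
  show "\<one> \<ominus> x \<in> carrier R" using in_carrier[OF assms] by simp
  have "\<one> = (\<one> \<ominus> x) \<oplus> x" using in_carrier[OF assms] by algebra
  thus "\<one> \<ominus> x \<notin> J" using add_in[OF _ assms] one_notin by metis
qed

text \<open>A right inverse \<open>s\<close> of \<open>r\<close> cannot lie in \<open>J\<close>, for otherwise \<open>1 - s r\<close> would have a right inverse \<open>t\<close>,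
  and \<open>r (1 - s r) = 0\<close> would give \<open>r = 0\<close>. So \<open>s\<close> has a right inverse too, which must be \<open>r\<close>.\<close>

lemma two_sided_inverse:
  assumes r: "r \<in> carrier R" "r \<notin> J"
  shows "\<exists>s\<in>carrier R. r \<otimes> s = \<one> \<and> s \<otimes> r = \<one>"
proof -
  obtain s where s: "s \<in> carrier R" "r \<otimes> s = \<one>" using right_inverse r by blast
  have "s \<notin> J"
  proof
    assume "s \<in> J"
    hence "s \<otimes> r \<in> J" using right_closed r by simp
    then obtain t where t: "t \<in> carrier R" "(\<one> \<ominus> s \<otimes> r) \<otimes> t = \<one>"
      using one_minus_right_inverse by blast
    have "r = r \<otimes> ((\<one> \<ominus> s \<otimes> r) \<otimes> t)" using t r by simp
    also have "\<dots> = (r \<ominus> (r \<otimes> s) \<otimes> r) \<otimes> t"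
      using r s(1) t(1) by algebra
    also have "\<dots> = \<zero>" using r s t(1) by (simp add: r_neg minus_eq)
    finally show False using zero_in r by simp
  qed
  then obtain u where u: "u \<in> carrier R" "s \<otimes> u = \<one>" using right_inverse s by blast
  have "r = r \<otimes> (s \<otimes> u)" using r u by simp
  also have "\<dots> = u" using r s u by (metis m_assoc l_one)
  finally show ?thesis using s u by auto
qed

text \<open>If \<open>s r x = 1\<close> with \<open>x \<in> J\<close>, then \<open>1 - x s r\<close> is invertible and annihilates \<open>x\<close> from the left, so
  \<open>x = 0\<close>.\<close>

lemma left_closed:
  assumes x: "x \<in> J" and r: "r \<in> carrier R"
  shows "r \<otimes> x \<in> J"
proof (rule ccontr)
  have xc: "x \<in> carrier R" using in_carrier x by simp
  assume "r \<otimes> x \<notin> J"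
  then obtain s where s: "s \<in> carrier R" "s \<otimes> (r \<otimes> x) = \<one>" using two_sided_inverse[of "r \<otimes> x"] r xc by auto
  have "x \<otimes> (s \<otimes> r) \<in> J" using right_closed x r s by simp
  then have "\<one> \<ominus> x \<otimes> (s \<otimes> r) \<in> carrier R" "\<one> \<ominus> x \<otimes> (s \<otimes> r) \<notin> J"
    using one_notin add_in[of "\<one> \<ominus> x \<otimes> (s \<otimes> r)" "x \<otimes> (s \<otimes> r)"] xc r s
    by (auto simp: minus_eq a_assoc l_neg)
  then obtain t where t: "t \<in> carrier R" "t \<otimes> (\<one> \<ominus> x \<otimes> (s \<otimes> r)) = \<one>" using two_sided_inverse by blast
  have "x = (t \<otimes> (\<one> \<ominus> x \<otimes> (s \<otimes> r))) \<otimes> x" using t xc by simp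
  also have "\<dots> = t \<otimes> (x \<ominus> x \<otimes> (s \<otimes> (r \<otimes> x)))" using t(1) s(1) r xc by algebra
  also have "\<dots> = \<zero>" using t(1) s(2) xc by (simp add: minus_eq r_neg)
  finally have "\<one> = \<zero>" using s r by simp
  thus False using zero_in one_notin by simp
qed

lemma ideal: "ideal J R"
  by (rule idealI[OF ring_axioms subgroup]) (auto intro: left_closed right_closed)

lemma proper_left_ideal_subset:
  assumes "left_ideal L R" "L \<noteq> carrier R"
  shows "L \<subseteq> J"
proof
  fix x assume x: "x \<in> L"
  have sub: "L \<subseteq> carrier R" 
    using assms(1) subgroup.subset unfolding left_ideal_def by force
  show "x \<in> J"
  proof (rule ccontr)
    assume "x \<notin> J"
    then obtain s where s: "s \<in> carrier R" "s \<otimes> x = \<one>" using two_sided_inverse x sub by blast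
    have "\<one> \<in> L" using assms(1) x s unfolding left_ideal_def by metis
    hence "r \<in> L" if "r \<in> carrier R" for r
      using assms(1) that unfolding left_ideal_def by (metis r_one)
    thus False using sub assms(2) by blast
  qed
qed

lemma jacobson_radical_eq: "jacobson_radical R = J"
proof -
  have li: "left_ideal J R" unfolding left_ideal_def using subgroup left_closed by blast
  have ne: "J \<noteq> carrier R" using one_notin by auto
  have max: "maximal_left_ideal J R"
    unfolding maximal_left_ideal_def using li ne proper_left_ideal_subset by blast
  have "I = J" if "maximal_left_ideal I R" for I
  proof -
    have "I \<subseteq> J" using that proper_left_ideal_subset unfolding maximal_left_ideal_def by blast
    thus ?thesis using that li ne unfolding maximal_left_ideal_def by blast
  qed
  thus ?thesis unfolding jacobson_radical_def using max in_carrier by blast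
qed

end


section \<open>Local algebras of finite length over a field\<close>

lemma scalars_simps [simp]:
  "carrier scalars = UNIV" "x \<otimes>\<^bsub>scalars\<^esub> y = x * y" "\<one>\<^bsub>scalars\<^esub> = 1"
  "x \<oplus>\<^bsub>scalars\<^esub> y = x + y" "\<zero>\<^bsub>scalars\<^esub> = 0"
  by (simp_all add: ring_of_type_algebra_def)

lemma scalars_minus [simp]: "\<ominus>\<^bsub>scalars\<^esub> (c :: 'k::comm_ring_1) = - c"
proof -
  interpret K: cring "scalars :: 'k ring" by (rule cring_from_type_algebra)
  show ?thesis by (rule K.minus_equality) simp_all
qed

lemma (in module) finsum_smult_rdistr:
  assumes "finite I" "c \<in> I \<rightarrow> carrier R" "x \<in> carrier M"
  shows "(\<Oplus>\<^bsub>M\<^esub>i\<in>I. c i \<odot>\<^bsub>M\<^esub> x) = (\<Oplus>\<^bsub>R\<^esub>i\<in>I. c i) \<odot>\<^bsub>M\<^esub> x"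
  using assms by (induct set: finite) (simp_all add: Pi_def smult_l_distr)

lemma finite_length_submodule_imp_submodule:
  assumes "module R M" and "finite_length_submodule R M N"
  shows "submodule N R M"
  using assms(2)
proof cases
  interpret module R M by fact
  case zero
  thus ?thesis by (auto intro!: submoduleI)
qed

text \<open>A composition series bounds the dimension. Passing from \<open>N\<close> to the next submodule \<open>N'\<close> adds a
  single generator \<open>x\<close>, since \<open>N + k x\<close> lies strictly above \<open>N\<close>; with one vector whose coefficient at
  \<open>x\<close> is nonzero the coefficients of all others can be eliminated, so that \<open>N'\<close> tolerates only one
  more independent vector than \<open>N\<close>.\<close>

lemma finite_length_imp_dependent:
  fixes M :: "('k::field, 'm, 'u) module_scheme" (structure)
  assumes "module scalars M" and "finite_length_submodule scalars M N"
  shows "\<exists>n. \<forall>I y. finite (I :: 'i set) \<and> card I > n \<and> y \<in> I \<rightarrow> N \<longrightarrow>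
    (\<exists>c. (\<exists>i\<in>I. c i \<noteq> 0) \<and> (\<Oplus>i\<in>I. c i \<odot> y i) = \<zero>)"
  using assms(2)
proof (induction rule: finite_length_submodule.induct)
  interpret module "scalars :: 'k ring" M by fact
  case zero
  have "(\<Oplus>i\<in>I. (1::'k) \<odot> y i) = \<zero>" if "y \<in> I \<rightarrow> {\<zero>}" for I and y :: "'i \<Rightarrow> 'm"
    using that by (induct I rule: infinite_finite_induct) (auto simp: Pi_def)
  then show ?case
    by (intro exI[of _ 0] allI impI exI[of _ "\<lambda>_. 1"]) (auto simp: card_gt_0_iff)
next
  interpret module "scalars :: 'k ring" M by fact
  case (step N N')
  interpret N: submodule N scalars M
    by (rule finite_length_submodule_imp_submodule[OF module_axioms step.hyps(1)])
  have N'c: "N' \<subseteq> carrier M" by (rule submoduleE(1)[OF step.hyps(2)])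
  obtain x where x: "x \<in> N'" "x \<notin> N" using step.hyps(3) by blast
  have xc: "x \<in> carrier M" using x N'c by blast
  note Nc = subsetD[OF submoduleE(1)[OF N.submodule_axioms]]
  have N_add: "a \<oplus> b \<in> N" if "a \<in> N" "b \<in> N" for a b
    using submoduleE(5)[OF N.submodule_axioms] that by blast
  have N_zero: "\<zero> \<in> N" using N.one_closed by simp
  define L where "L = {a \<oplus> c \<odot> x |a c. a \<in> N}"
  have "submodule L scalars M"
  proof (rule submoduleI)
    show "L \<subseteq> carrier M" unfolding L_def using Nc xc by auto
    have "\<zero> = \<zero> \<oplus> 0 \<odot> x" using smult_l_null xc by simp
    thus "\<zero> \<in> L" unfolding L_def using N_zero by blast
  next
    fix u assume "u \<in> L"
    then obtain a c where u: "u = a \<oplus> c \<odot> x" "a \<in> N" unfolding L_def by blast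
    have "\<ominus> u = (\<ominus> a) \<oplus> (- c) \<odot> x"
      using u Nc xc smult_l_minus[of c x] by (simp add: M.minus_add)
    thus "\<ominus> u \<in> L" unfolding L_def using submoduleE(3)[OF N.submodule_axioms] u by blast
  next
    fix u v assume "u \<in> L" "v \<in> L"
    then obtain a c b d where u: "u = a \<oplus> c \<odot> x" "a \<in> N" "v = b \<oplus> d \<odot> x" "b \<in> N"
      unfolding L_def by blast
    have "u \<oplus> v = (a \<oplus> b) \<oplus> (c + d) \<odot> x"
      using u Nc xc smult_l_distr[of c d x] by (simp add: M.add.m_ac)
    thus "u \<oplus> v \<in> L" unfolding L_def using N_add u by blast
  next
    fix e :: 'k and u assume "u \<in> L"
    then obtain a c where u: "u = a \<oplus> c \<odot> x" "a \<in> N" unfolding L_def by blast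
    have "e \<odot> u = e \<odot> a \<oplus> (e * c) \<odot> x"
      using u Nc xc smult_assoc1[of e c x] by (simp add: smult_r_distr)
    moreover have "e \<odot> a \<in> N" using N.smult_closed u by simp
    ultimately show "e \<odot> u \<in> L" unfolding L_def using u by blast
  qed
  moreover have "N \<subseteq> L"
  proof
    fix a assume "a \<in> N"
    moreover have "a = a \<oplus> 0 \<odot> x" using smult_l_null xc Nc \<open>a \<in> N\<close> by simp
    ultimately show "a \<in> L" unfolding L_def by blast
  qed
  moreover have "L \<subseteq> N'"
    unfolding L_def using step.hyps(3) x(1) submoduleE(4,5)[OF step.hyps(2)] by auto
  moreover have "x \<in> L"
  proof -
    have "x = \<zero> \<oplus> 1 \<odot> x" using smult_one xc by simp
    thus ?thesis unfolding L_def using N_zero by blast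
  qed
  ultimately have L: "N' = L" using step.hyps(4)[of L] x by blast
  obtain n where n: "\<And>I (y :: 'i \<Rightarrow> 'm). finite I \<Longrightarrow> card I > n \<Longrightarrow> y \<in> I \<rightarrow> N \<Longrightarrow>
      \<exists>c. (\<exists>i\<in>I. c i \<noteq> 0) \<and> (\<Oplus>i\<in>I. c i \<odot> y i) = \<zero>"
    using step.IH by blast
  show ?case
  proof (intro exI[of _ "Suc n"] allI impI, elim conjE)
    fix I :: "'i set" and y :: "'i \<Rightarrow> 'm"
    assume I: "finite I" "Suc n < card I" "y \<in> I \<rightarrow> N'"
    have "\<forall>i\<in>I. \<exists>a d. y i = a \<oplus> d \<odot> x \<and> a \<in> N" using I(3) unfolding L L_def by fast
    then obtain a d where y: "\<And>i. i \<in> I \<Longrightarrow> y i = a i \<oplus> d i \<odot> x" and a: "\<And>i. i \<in> I \<Longrightarrow> a i \<in> N"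
      by metis
    show "\<exists>c. (\<exists>i\<in>I. c i \<noteq> 0) \<and> (\<Oplus>i\<in>I. c i \<odot> y i) = \<zero>"
    proof (cases "\<forall>i\<in>I. d i = 0")
      case True
      hence "y \<in> I \<rightarrow> N" using y a xc Nc smult_l_null by auto
      thus ?thesis using n[of I y] I by simp
    next
      case False
      then obtain j where j: "j \<in> I" "d j \<noteq> 0" by blast
      define I' where "I' = I - {j}"
      have I': "I = insert j I'" "finite I'" "j \<notin> I'" "n < card I'"
        using I j unfolding I'_def by auto
      \<comment> \<open>elimination of \<open>x\<close> from \<open>y i\<close> by means of \<open>y j\<close>\<close>
      define y' where "y' i = a i \<oplus> (- (d i / d j)) \<odot> a j" for i
      have y'N: "y' i \<in> N" if "i \<in> I'" for i
        unfolding y'_def using that a I' N_add N.smult_closed by simp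
      then obtain c where c: "\<exists>i\<in>I'. c i \<noteq> 0" "(\<Oplus>i\<in>I'. c i \<odot> y' i) = \<zero>"
        using n[of I' y'] I' by auto
      define s where "s = (\<Oplus>\<^bsub>scalars\<^esub>i\<in>I'. c i * (d i / d j))"
      have yc: "y i \<in> carrier M" if "i \<in> I" for i using that I(3) N'c by auto
      have y'c: "y' i \<in> carrier M" if "i \<in> I'" for i using y'N Nc that by blast
      have decomp: "c i \<odot> y i = c i \<odot> y' i \<oplus> (c i * (d i / d j)) \<odot> y j" if "i \<in> I'" for i
      proof -
        have ii: "i \<in> I" using that I' by simp
        have ac: "a i \<in> carrier M" "a j \<in> carrier M" using a Nc ii j by auto
        have "(d i / d j) \<odot> y j = (d i / d j) \<odot> a j \<oplus> d i \<odot> x"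
          using y[OF j(1)] ac xc j(2) smult_assoc1[of "d i / d j" "d j" x]
          by (simp add: smult_r_distr)
        moreover have "(- (d i / d j)) \<odot> a j = \<ominus> ((d i / d j) \<odot> a j)"
          using smult_l_minus[of "d i / d j" "a j"] ac by simp
        ultimately have "y i = y' i \<oplus> (d i / d j) \<odot> y j"
          unfolding y'_def using ac xc y[OF ii] 
          by (simp add: M.add.m_assoc) (simp add: M.add.m_assoc[symmetric] M.l_neg)
        thus ?thesis using smult_r_distr[of "c i" "y' i" "(d i / d j) \<odot> y j"] y'c[OF that]
          yc[OF j(1)] smult_assoc1[of "c i" "d i / d j" "y j"] by simp
      qed
      have "(\<Oplus>i\<in>I'. c i \<odot> y i) = (\<Oplus>i\<in>I'. c i \<odot> y' i \<oplus> (c i * (d i / d j)) \<odot> y j)"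
        using decomp y'c yc[OF j(1)] by (intro M.finsum_cong') auto
      also have "\<dots> = (\<Oplus>i\<in>I'. c i \<odot> y' i) \<oplus> (\<Oplus>i\<in>I'. (c i * (d i / d j)) \<odot> y j)"
        using y'c yc[OF j(1)] by (intro M.finsum_addf) auto
      also have "\<dots> = s \<odot> y j"
        unfolding s_def using c(2) finsum_smult_rdistr[of I' "\<lambda>i. c i * (d i / d j)" "y j"] yc[OF j(1)] I'(2)
        by simp
      finally have sum: "(\<Oplus>i\<in>I'. c i \<odot> y i) = s \<odot> y j" .
      \<comment> \<open>the coefficient at \<open>j\<close> compensates the multiples of \<open>y j\<close> subtracted above\<close>
      let ?c = "c(j := - s)"
      have "(\<Oplus>i\<in>I. ?c i \<odot> y i) = (- s) \<odot> y j \<oplus> (\<Oplus>i\<in>I'. ?c i \<odot> y i)"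
        unfolding I'(1) using I' yc by (subst M.finsum_insert) auto
      also have "(\<Oplus>i\<in>I'. ?c i \<odot> y i) = (\<Oplus>i\<in>I'. c i \<odot> y i)"
        using I' yc by (intro M.finsum_cong') auto
      also have "(- s) \<odot> y j \<oplus> \<dots> = \<zero>"
        unfolding sum using smult_l_minus[of s "y j"] yc[OF j(1)] by (simp add: M.l_neg)
      finally have "(\<Oplus>i\<in>I. ?c i \<odot> y i) = \<zero>" .
      moreover have "\<exists>i\<in>I. ?c i \<noteq> 0" using c(1) I' by (metis fun_upd_other insertI2)
      ultimately show ?thesis by blast
    qed
  qed
qed


locale finite_length_local_algebra = module scalars E + local_ring E J
  for E :: "('k::alg_closed_field, 'm) module" (structure) and J +
  assumes smult_mult_left: "x \<in> carrier E \<Longrightarrow> y \<in> carrier E \<Longrightarrow> (c \<odot> x) \<otimes> y = c \<odot> (x \<otimes> y)"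
    and smult_mult_right: "x \<in> carrier E \<Longrightarrow> y \<in> carrier E \<Longrightarrow> x \<otimes> (c \<odot> y) = c \<odot> (x \<otimes> y)"
    and finite_length: "finite_length_module scalars E"
begin

lemma smult_in_carrier [simp]: "x \<in> carrier E \<Longrightarrow> c \<odot> x \<in> carrier E"
  using smult_closed by simp

text \<open>The laws of the scalar action in terms of the operations of the type \<open>'k\<close> instead of those of
  the ring \<open>scalars\<close>.\<close>

lemma smult_smult: "x \<in> carrier E \<Longrightarrow> c \<odot> (d \<odot> x) = (c * d) \<odot> x"
  using smult_assoc1[of c d x] by (simp only: scalars_simps UNIV_I simp_thms)

lemma one_smult [simp]: "x \<in> carrier E \<Longrightarrow> 1 \<odot> x = x"
  using smult_one[of x] by (simp only: scalars_simps)

lemma zero_smult [simp]: "x \<in> carrier E \<Longrightarrow> 0 \<odot> x = \<zero>"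
  using smult_l_null[of x] by (simp only: scalars_simps)

lemma add_smult: "y \<in> carrier E \<Longrightarrow> (c + d) \<odot> y = c \<odot> y \<oplus> d \<odot> y"
  using smult_l_distr[of c d y] by (simp only: scalars_simps UNIV_I simp_thms)

lemma smult_add: "y \<in> carrier E \<Longrightarrow> z \<in> carrier E \<Longrightarrow> c \<odot> (y \<oplus> z) = c \<odot> y \<oplus> c \<odot> z"
  using smult_r_distr[of c y z] by (simp only: scalars_simps UNIV_I simp_thms)

lemma uminus_smult: "y \<in> carrier E \<Longrightarrow> (- c) \<odot> y = \<ominus> (c \<odot> y)"
  using smult_l_minus[of c y] by (simp only: scalars_simps scalars_minus UNIV_I simp_thms)

lemma dependent:
  "\<exists>n. \<forall>y. (\<forall>i. y i \<in> carrier E) \<longrightarrow>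
     (\<exists>c. (\<exists>i\<le>n. c i \<noteq> 0) \<and> (\<Oplus>i\<in>{..n::nat}. c i \<odot> y i) = \<zero>)"
proof -
  obtain n where n: "\<And>I (y :: nat \<Rightarrow> 'm). finite I \<Longrightarrow> card I > n \<Longrightarrow> y \<in> I \<rightarrow> carrier E \<Longrightarrow>
      \<exists>c. (\<exists>i\<in>I. c i \<noteq> 0) \<and> (\<Oplus>i\<in>I. c i \<odot> y i) = \<zero>"
    using finite_length_imp_dependent[OF module_axioms finite_length[unfolded finite_length_module_def],
        where 'i = nat] by (elim exE) metis
  have "\<exists>c. (\<exists>i\<le>n. c i \<noteq> 0) \<and> (\<Oplus>i\<in>{..n}. c i \<odot> y i) = \<zero>"
    if "\<forall>i. y i \<in> carrier E" for y
    using n[of "{..n}" y] that by (simp add: Bex_def)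
  thus ?thesis by blast
qed

lemma scalar_in_J_iff: "c \<odot> \<one> \<in> J \<longleftrightarrow> c = 0"
proof
  assume "c \<odot> \<one> \<in> J"
  hence "c \<odot> \<one> \<otimes> (inverse c \<odot> \<one>) \<in> J" by (rule right_closed) simp
  moreover have "c \<odot> \<one> \<otimes> (inverse c \<odot> \<one>) = (c * inverse c) \<odot> \<one>"
    by (simp add: smult_mult_left smult_smult)
  ultimately show "c = 0" using one_notin by (cases "c = 0") auto
qed (use zero_in in simp)

lemma multiple_in_J:
  assumes y: "\<And>i. y i \<in> carrier E" and step: "\<And>i. \<exists>x\<in>J. y (Suc i) = x \<otimes> y i" and "k < i"
  shows "\<exists>z\<in>J. y i = z \<otimes> y k"
  using \<open>k < i\<close>
proof (induction i)
  case (Suc i)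
  obtain x where x: "x \<in> J" "y (Suc i) = x \<otimes> y i" using step by blast
  show ?case
  proof (cases "k = i")
    case False
    then obtain z where z: "z \<in> J" "y i = z \<otimes> y k" using Suc by auto
    have "y (Suc i) = (x \<otimes> z) \<otimes> y k" using x z in_carrier y by (simp add: m_assoc)
    moreover have "x \<otimes> z \<in> J" using x z right_closed in_carrier by simp
    ultimately show ?thesis by blast
  next
    case True
    thus ?thesis using x by blast
  qed
qed (rule less_zeroE)

lemma smult_in_J: "x \<in> J \<Longrightarrow> c \<odot> x \<in> J"
  using right_closed[of x "c \<odot> \<one>"] in_carrier[of x] by (simp add: smult_mult_right)

text \<open>Along a sequence in which each term is a \<open>J\<close>-multiple of its predecessor, a linear relation reads
  \<open>(c + z) y\<^sub>k = 0\<close>, where \<open>c \<noteq> 0\<close> is its first nonzero coefficient and \<open>z \<in> J\<close> collects all later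
  terms. Since \<open>c + z\<close> is invertible, \<open>y\<^sub>k = 0\<close>.\<close>

lemma chain_vanishes:
  assumes y: "\<And>i. y i \<in> carrier E" and step: "\<And>i. \<exists>x\<in>J. y (Suc i) = x \<otimes> y i"
    and sum: "(\<Oplus>i\<in>{..n}. c i \<odot> y i) = \<zero>" and c: "\<exists>i\<le>n. c i \<noteq> 0"
  shows "\<exists>k\<le>n. y k = \<zero>"
proof -
  define k where "k = (LEAST i. c i \<noteq> 0)"
  obtain i where i: "i \<le> n" "c i \<noteq> 0" using c by blast
  have ck: "c k \<noteq> 0"
    unfolding k_def using i(2) by (rule LeastI)
  have kn: "k \<le> n"
    unfolding k_def using Least_le[of "\<lambda>i. c i \<noteq> 0", OF i(2)] i(1) by (rule order_trans)
  have k3: "c i = 0" if "i < k" for i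
    using not_less_Least that unfolding k_def by blast
  note k = ck kn k3
  have tail: "\<exists>z\<in>J. (\<Oplus>i\<in>I. c i \<odot> y i) = z \<otimes> y k" if "finite I" "\<forall>i\<in>I. i > k" for I
    using that
  proof (induction I)
    case empty
    thus ?case using zero_in y by (intro bexI[of _ \<zero>]) auto
  next
    case (insert i I)
    then obtain z where z: "z \<in> J" "(\<Oplus>i\<in>I. c i \<odot> y i) = z \<otimes> y k" by auto
    obtain w where w: "w \<in> J" "y i = w \<otimes> y k" using multiple_in_J[of y k i, OF y step] insert.prems by auto
    have "(\<Oplus>i\<in>insert i I. c i \<odot> y i) = (c i \<odot> w \<oplus> z) \<otimes> y k"
      using insert.hyps z w y in_carrier
      by (subst finsum_insert) (auto simp: smult_mult_left l_distr)
    moreover have "c i \<odot> w \<oplus> z \<in> J" using z w add_in smult_in_J by simp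
    ultimately show ?case by blast
  qed
  have I: "{..n} = {..<k} \<union> insert k {k<..n}" using k(2) by auto
  obtain z where z: "z \<in> J" "(\<Oplus>i\<in>{k<..n}. c i \<odot> y i) = z \<otimes> y k" using tail[of "{k<..n}"] by auto
  have "(\<Oplus>i\<in>{..n}. c i \<odot> y i) = (\<Oplus>i\<in>{..<k}. c i \<odot> y i) \<oplus> (\<Oplus>i\<in>insert k {k<..n}. c i \<odot> y i)"
    unfolding I using y by (intro finsum_Un_disjoint) auto
  also have "(\<Oplus>i\<in>{..<k}. c i \<odot> y i) = (\<Oplus>i\<in>{..<k}. \<zero>)"
    using k(3) y by (intro finsum_cong') auto
  also have "\<dots> = \<zero>" by simp
  also have "(\<Oplus>i\<in>insert k {k<..n}. c i \<odot> y i) = c k \<odot> y k \<oplus> z \<otimes> y k"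
    using y z(2) by (subst finsum_insert) auto
  finally have eq: "(c k \<odot> \<one> \<oplus> z) \<otimes> y k = \<zero>"
    using sum y in_carrier[OF z(1)] by (simp add: l_distr smult_mult_left)
  have "c k \<odot> \<one> \<oplus> z \<notin> J"
  proof
    assume "c k \<odot> \<one> \<oplus> z \<in> J"
    hence "(c k \<odot> \<one> \<oplus> z) \<oplus> \<ominus> z \<in> J" using add_in minus_in z by blast
    thus False using scalar_in_J_iff k(1) in_carrier[OF z(1)] by (simp add: a_assoc r_neg)
  qed
  then obtain s where s: "s \<in> carrier E" "s \<otimes> (c k \<odot> \<one> \<oplus> z) = \<one>"
    using two_sided_inverse[of "c k \<odot> \<one> \<oplus> z"] in_carrier[OF z(1)] by auto
  have "y k = s \<otimes> ((c k \<odot> \<one> \<oplus> z) \<otimes> y k)"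
    using s y in_carrier[OF z(1)] by (simp add: m_assoc[symmetric])
  thus ?thesis using eq s k(2) by auto
qed

text \<open>If any \<open>n + 1\<close> elements are dependent, then a product of \<open>n\<close> factors from \<open>J\<close> vanishes: together with
  \<open>1\<close>, its right-hand partial products form a dependent sequence of the kind just considered.\<close>

lemma nilpotent: "nilpotent_ideal J E"
proof -
  obtain n where n: "\<And>y. (\<forall>i. y i \<in> carrier E) \<Longrightarrow>
     (\<exists>c. (\<exists>i\<le>n. c i \<noteq> 0) \<and> (\<Oplus>i\<in>{..n::nat}. c i \<odot> y i) = \<zero>)"
    using dependent by blast
  have "foldr (\<otimes>) xs \<one> = \<zero>" if xs: "length xs = n" "set xs \<subseteq> J" for xs
  proof -
    \<comment> \<open>the partial products are built up from the last factor; beyond the list the value is irrelevant\<close>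
    define x where "x i = (if i < n then rev xs ! i else \<zero>)" for i
    have x: "x i \<in> J" for i
      unfolding x_def using xs zero_in nth_mem[of i "rev xs"] by auto
    define y where "y = rec_nat \<one> (\<lambda>i v. x i \<otimes> v)"
    have y_simps: "y 0 = \<one>" "y (Suc i) = x i \<otimes> y i" for i by (simp_all add: y_def)
    have yc: "y i \<in> carrier E" for i
      by (induction i) (use x in_carrier in \<open>auto simp: y_simps\<close>)
    have prod: "i \<le> n \<Longrightarrow> y i = foldr (\<otimes>) (rev (take i (rev xs))) \<one>" for i
      by (induction i) (auto simp: y_simps x_def take_Suc_conv_app_nth xs)
    have step: "\<exists>w\<in>J. y (Suc i) = w \<otimes> y i" for i
      using x[of i] y_simps(2)[of i] by (rule rev_bexI)
    obtain c where c: "\<exists>i\<le>n. c i \<noteq> 0" "(\<Oplus>i\<in>{..n}. c i \<odot> y i) = \<zero>"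
      using n[of y] yc by blast
    obtain k where k: "k \<le> n" "y k = \<zero>"
      using chain_vanishes[OF yc step c(2,1)] by blast
    have "k \<le> i \<Longrightarrow> y i = \<zero>" for i
      by (induction i rule: dec_induct) (use k x in_carrier in \<open>auto simp: y_simps\<close>)
    hence "y n = \<zero>" using k by simp
    thus ?thesis using prod[of n] xs by simp
  qed
  thus ?thesis unfolding nilpotent_ideal_def by blast
qed

text \<open>Evaluation of a polynomial at an element of the algebra, by the scheme of Horner.\<close>

definition aeval :: "'m \<Rightarrow> 'k poly \<Rightarrow> 'm" where
  "aeval x q = fold_coeffs (\<lambda>a v. a \<odot> \<one> \<oplus> x \<otimes> v) q \<zero>"

context
  fixes x assumes x: "x \<in> carrier E"
begin

lemma aeval_0 [simp]: "aeval x 0 = \<zero>"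
  by (simp add: aeval_def)

lemma aeval_pCons: "aeval x (pCons a q) = a \<odot> \<one> \<oplus> x \<otimes> aeval x q"
  by (cases "a = 0 \<and> q = 0") (auto simp: aeval_def x)

lemma aeval_closed [simp]: "aeval x q \<in> carrier E"
  by (induction q) (auto simp: aeval_pCons x)

lemma aeval_smult: "aeval x (smult b q) = b \<odot> aeval x q"
proof (induction q)
  case 0
  have "b \<odot> \<zero> = \<zero>" by (rule smult_r_null) simp
  thus ?case by simp
next
  case (pCons a q)
  thus ?case by (simp add: aeval_pCons x smult_add smult_smult smult_mult_right)
qed

lemma aeval_add: "aeval x (p + q) = aeval x p \<oplus> aeval x q"
proof (induction p arbitrary: q)
  case (pCons a p)
  show ?case by (cases q) (simp add: aeval_pCons pCons.IH x add_smult r_distr a_ac)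
qed simp

lemma aeval_linear_factor: "aeval x ([:- c, 1:] * q) = (x \<ominus> c \<odot> \<one>) \<otimes> aeval x q"
proof -
  have "[:- c, 1:] * q = pCons 0 q + Polynomial.smult (- c) q" by simp
  hence "aeval x ([:- c, 1:] * q) = x \<otimes> aeval x q \<oplus> (- c) \<odot> aeval x q"
    by (simp only: aeval_add aeval_smult) (simp add: aeval_pCons x)
  thus ?thesis by (simp add: x uminus_smult minus_eq l_distr l_minus smult_mult_left)
qed

text \<open>Turns a linear relation between the powers of \<open>x\<close> into a polynomial that annihilates \<open>x\<close>.\<close>

lemma aeval_of_coeffs: "\<exists>q. aeval x q = (\<Oplus>i\<in>{..n}. c i \<odot> x [^] i) \<and> (\<forall>i\<le>n. Polynomial.coeff q i = c i)"
proof (induction n arbitrary: c)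
  case 0
  have "aeval x [:c 0:] = c 0 \<odot> \<one>" by (simp add: aeval_pCons x)
  thus ?case by (intro exI[of _ "[:c 0:]"]) (simp add: finsum_0)
next
  case (Suc n)
  obtain q where q: "aeval x q = (\<Oplus>i\<in>{..n}. c (Suc i) \<odot> x [^] i)" "\<forall>i\<le>n. Polynomial.coeff q i = c (Suc i)"
    using Suc.IH[of "\<lambda>i. c (Suc i)"] by blast
  have "x \<otimes> aeval x q = (\<Oplus>i\<in>{..n}. x \<otimes> (c (Suc i) \<odot> x [^] i))"
    unfolding q(1) by (rule finsum_rdistr) (auto simp: x)
  also have "\<dots> = (\<Oplus>i\<in>{..n}. c (Suc i) \<odot> x [^] Suc i)"
  proof (rule finsum_cong')
    fix i :: nat
    have "x \<otimes> x [^] i = x [^] i \<otimes> x" using nat_pow_Suc2[OF x, of i] by simp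
    thus "x \<otimes> (c (Suc i) \<odot> x [^] i) = c (Suc i) \<odot> x [^] Suc i"
      by (simp add: x smult_mult_right)
  qed (auto simp: x)
  finally have "aeval x (pCons (c 0) q) = (\<Oplus>i\<in>{..Suc n}. c i \<odot> x [^] i)"
    by (subst finsum_Suc2) (auto simp: x aeval_pCons a_comm)
  moreover have "Polynomial.coeff (pCons (c 0) q) i = c i" if "i \<le> Suc n" for i
    using q(2) that by (cases i) auto
  ultimately show ?case by blast
qed

text \<open>Existence of an eigenvalue: in a factorisation of an annihilating polynomial into linear factors not
  all \<open>x - c\<close> can be invertible, and a non-invertible element lies in \<open>J\<close>.\<close>

lemma exists_scalar_mod_J_if_root: "Polynomial.degree q \<le> n \<Longrightarrow> q \<noteq> 0 \<Longrightarrow> aeval x q = \<zero> \<Longrightarrow> \<exists>c. x \<ominus> c \<odot> \<one> \<in> J"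
proof (induction n arbitrary: q)
  case 0
  then obtain a where a: "q = [:a:]" using degree_0_id[of q] by (metis le_zero_eq)
  hence "a \<odot> \<one> = \<zero>" using "0.prems"(3) by (simp add: aeval_pCons x)
  hence "a = 0" using scalar_in_J_iff[of a] zero_in by simp
  thus ?case using a "0.prems"(2) by simp
next
  case (Suc n)
  show ?case
  proof (cases "Polynomial.degree q = 0")
    case True
    thus ?thesis using Suc.IH[of q] Suc.prems by simp
  next
    case False
    then obtain c where "poly q c = 0" using alg_closed_imp_poly_has_root[of q] by auto
    then obtain r where r: "q = [:- c, 1:] * r" by (auto simp: poly_eq_0_iff_dvd elim: dvdE)
    have r0: "r \<noteq> 0" using r Suc.prems(2) by auto
    have "Polynomial.degree q = Suc (Polynomial.degree r)" unfolding r using r0 by (subst degree_mult_eq) auto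
    hence deg: "Polynomial.degree r \<le> n" using Suc.prems(1) by simp
    show ?thesis
    proof (cases "x \<ominus> c \<odot> \<one> \<in> J")
      case False
      then obtain s where s: "s \<in> carrier E" "s \<otimes> (x \<ominus> c \<odot> \<one>) = \<one>"
        using two_sided_inverse[of "x \<ominus> c \<odot> \<one>"] x by auto
      have "aeval x r = s \<otimes> ((x \<ominus> c \<odot> \<one>) \<otimes> aeval x r)"
        using s x by (simp add: m_assoc[symmetric])
      also have "\<dots> = s \<otimes> aeval x q" unfolding r aeval_linear_factor ..
      also have "\<dots> = \<zero>" using Suc.prems(3) s by simp
      finally show ?thesis by (rule Suc.IH[OF deg r0])
    qed blast
  qed
qed

lemma exists_scalar_mod_J: "\<exists>c. x \<ominus> c \<odot> \<one> \<in> J"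
proof -
  obtain n where n: "\<And>y. (\<forall>i. y i \<in> carrier E) \<Longrightarrow>
     (\<exists>c. (\<exists>i\<le>n. c i \<noteq> 0) \<and> (\<Oplus>i\<in>{..n::nat}. c i \<odot> y i) = \<zero>)"
    using dependent by blast
  obtain c where c: "\<exists>i\<le>n. c i \<noteq> 0" "(\<Oplus>i\<in>{..n}. c i \<odot> x [^] i) = \<zero>"
    using n[of "\<lambda>i. x [^] i"] x by auto
  obtain q where "aeval x q = (\<Oplus>i\<in>{..n}. c i \<odot> x [^] i)" "\<forall>i\<le>n. Polynomial.coeff q i = c i"
    using aeval_of_coeffs by blast
  moreover have "q \<noteq> 0" using calculation(2) c(1) by auto
  ultimately show ?thesis using c(2) exists_scalar_mod_J_if_root[OF order_refl] by simp
qed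

end

text \<open>Surjectivity is the existence of eigenvalues, injectivity holds because nonzero scalars are
  invertible.\<close>

lemma scalars_iso_quotient: "(\<lambda>c. J +> (c \<odot> \<one>)) \<in> ring_iso scalars (E Quot J)"
proof (rule ring_iso_memI)
  interpret J: ideal J E by (rule ideal)
  have hom: "(+>) J \<in> ring_hom E (E Quot J)" by (rule J.rcos_ring_hom)
  fix c d :: 'k
  show "J +> (c \<odot> \<one>) \<in> carrier (E Quot J)" by (rule ring_hom_closed[OF hom]) simp
  have "(c * d) \<odot> \<one> = (c \<odot> \<one>) \<otimes> (d \<odot> \<one>)" by (simp add: smult_smult smult_mult_left)
  thus "J +> ((c \<otimes>\<^bsub>scalars\<^esub> d) \<odot> \<one>) = (J +> (c \<odot> \<one>)) \<otimes>\<^bsub>E Quot J\<^esub> (J +> (d \<odot> \<one>))"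
    using ring_hom_mult[OF hom] by simp
  have "(c + d) \<odot> \<one> = (c \<odot> \<one>) \<oplus> (d \<odot> \<one>)" by (simp add: add_smult)
  thus "J +> ((c \<oplus>\<^bsub>scalars\<^esub> d) \<odot> \<one>) = (J +> (c \<odot> \<one>)) \<oplus>\<^bsub>E Quot J\<^esub> (J +> (d \<odot> \<one>))"
    using ring_hom_add[OF hom] by simp
  show "J +> (\<one>\<^bsub>scalars\<^esub> \<odot> \<one>) = \<one>\<^bsub>E Quot J\<^esub>" using ring_hom_one[OF hom] by simp
next
  interpret J: ideal J E by (rule ideal)
  have eq: "J +> x = J +> y \<longleftrightarrow> x \<ominus> y \<in> J" if "x \<in> carrier E" "y \<in> carrier E" for x y
    using quotient_eq_iff_same_a_r_cos[OF ideal that] by blast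
  show "bij_betw (\<lambda>c. J +> (c \<odot> \<one>)) (carrier scalars) (carrier (E Quot J))"
  proof (rule bij_betw_imageI)
    show "inj_on (\<lambda>c. J +> (c \<odot> \<one>)) (carrier scalars)"
    proof (rule inj_onI)
      fix c d :: 'k
      assume "J +> (c \<odot> \<one>) = J +> (d \<odot> \<one>)"
      hence "c \<odot> \<one> \<ominus> d \<odot> \<one> \<in> J" using eq by simp
      moreover have "c \<odot> \<one> \<ominus> d \<odot> \<one> = (c - d) \<odot> \<one>"
        using add_smult[of \<one> c "- d"] by (simp add: uminus_smult minus_eq)
      ultimately show "c = d" using scalar_in_J_iff by simp
    qed
    show "(\<lambda>c. J +> (c \<odot> \<one>)) ` carrier scalars = carrier (E Quot J)"
    proof (intro equalityI subsetI)
      fix X assume "X \<in> carrier (E Quot J)"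
      then obtain x where x: "x \<in> carrier E" "X = J +> x"
        by (auto simp: FactRing_def A_RCOSETS_def')
      obtain c where "x \<ominus> c \<odot> \<one> \<in> J" using exists_scalar_mod_J x by blast
      hence "X = J +> (c \<odot> \<one>)" using eq x by simp
      thus "X \<in> (\<lambda>c. J +> (c \<odot> \<one>)) ` carrier scalars" by simp
    qed (auto intro: ring_hom_closed[OF J.rcos_ring_hom])
  qed
qed

end


section \<open>Linear and abelian categories\<close>

context linear_category
begin

lemma in_Hom_iff: "f \<in> Hom C X Y \<longleftrightarrow> src C f = X \<and> tgt C f = Y"
  by (simp add: Hom_def)

lemma in_Hom [simp]: "f \<in> Hom C (src C f) (tgt C f)"
  by (simp add: Hom_def)

text \<open>The axioms in terms of sources and targets, so that the simplifier can check composability by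
  computing with objects.\<close>

lemma src_id [simp]: "src C (\<iota> X) = X" and tgt_id [simp]: "tgt C (\<iota> X) = X"
  using id_in_Hom by (auto simp: in_Hom_iff)

lemma src_comp [simp]: "tgt C f = src C g \<Longrightarrow> src C (g \<cdot> f) = src C f"
  and tgt_comp [simp]: "tgt C f = src C g \<Longrightarrow> tgt C (g \<cdot> f) = tgt C g"
  using comp_in_Hom[of f "src C f" "src C g" g "tgt C g"] by (auto simp: in_Hom_iff)

lemma id_comp [simp]: "tgt C f = Y \<Longrightarrow> \<iota> Y \<cdot> f = f"
  using comp_id_left by (auto simp: in_Hom_iff)

lemma comp_id [simp]: "src C f = X \<Longrightarrow> f \<cdot> \<iota> X = f"
  using comp_id_right by (auto simp: in_Hom_iff)

lemma assoc: "tgt C f = src C g \<Longrightarrow> tgt C g = src C h \<Longrightarrow> (h \<cdot> g) \<cdot> f = h \<cdot> (g \<cdot> f)"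
  using comp_assoc[of f "src C f" "src C g" g "src C h" h "tgt C h"] by (simp add: in_Hom_iff)

lemma carrier_Hom_module [simp]: "carrier (Hom_module C X Y) = Hom C X Y"
  and mult_Hom_module [simp]: "f \<otimes>\<^bsub>Hom_module C X Y\<^esub> g = f \<cdot> g"
  and one_Hom_module [simp]: "\<one>\<^bsub>Hom_module C X Y\<^esub> = \<iota> X"
  and zero_Hom_module [simp]: "\<zero>\<^bsub>Hom_module C X Y\<^esub> = \<zero>\<^sub>m X Y"
  and add_Hom_module [simp]: "f \<oplus>\<^bsub>Hom_module C X Y\<^esub> g = f \<oplus>\<^sub>m g"
  and smult_Hom_module [simp]: "c \<odot>\<^bsub>Hom_module C X Y\<^esub> f = c \<odot>\<^sub>m f"
  by (simp_all add: Hom_module_def)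

lemma src_zero [simp]: "src C (\<zero>\<^sub>m X Y) = X" and tgt_zero [simp]: "tgt C (\<zero>\<^sub>m X Y) = Y"
proof -
  interpret M: module scalars "Hom_module C X Y" by (rule Hom_module)
  show "src C (\<zero>\<^sub>m X Y) = X" "tgt C (\<zero>\<^sub>m X Y) = Y" using M.zero_closed by (simp_all add: in_Hom_iff)
qed

lemma src_add [simp]: "src C f = src C g \<Longrightarrow> tgt C f = tgt C g \<Longrightarrow> src C (f \<oplus>\<^sub>m g) = src C g"
  and tgt_add [simp]: "src C f = src C g \<Longrightarrow> tgt C f = tgt C g \<Longrightarrow> tgt C (f \<oplus>\<^sub>m g) = tgt C g"
proof -
  interpret M: module scalars "Hom_module C (src C g) (tgt C g)" by (rule Hom_module)
  assume "src C f = src C g" "tgt C f = tgt C g"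
  thus "src C (f \<oplus>\<^sub>m g) = src C g" "tgt C (f \<oplus>\<^sub>m g) = tgt C g"
    using M.a_closed[of f g] by (simp_all add: in_Hom_iff)
qed

lemma src_scale [simp]: "src C (c \<odot>\<^sub>m f) = src C f" and tgt_scale [simp]: "tgt C (c \<odot>\<^sub>m f) = tgt C f"
proof -
  interpret M: module scalars "Hom_module C (src C f) (tgt C f)" by (rule Hom_module)
  show "src C (c \<odot>\<^sub>m f) = src C f" "tgt C (c \<odot>\<^sub>m f) = tgt C f"
    using M.smult_closed[of c f] by (simp_all add: in_Hom_iff)
qed

lemma zero_scale [simp]: "0 \<odot>\<^sub>m f = \<zero>\<^sub>m (src C f) (tgt C f)"
  and one_scale [simp]: "1 \<odot>\<^sub>m f = f"
  and scale_scale: "c \<odot>\<^sub>m (d \<odot>\<^sub>m f) = (c * d) \<odot>\<^sub>m f"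
  and scale_add_left: "(c + d) \<odot>\<^sub>m f = c \<odot>\<^sub>m f \<oplus>\<^sub>m d \<odot>\<^sub>m f"
  and scale_zero [simp]: "c \<odot>\<^sub>m \<zero>\<^sub>m X Y = \<zero>\<^sub>m X Y"
  and add_zero: "f \<oplus>\<^sub>m \<zero>\<^sub>m (src C f) (tgt C f) = f"
proof -
  interpret M: module scalars "Hom_module C (src C f) (tgt C f)" by (rule Hom_module)
  show "0 \<odot>\<^sub>m f = \<zero>\<^sub>m (src C f) (tgt C f)" using M.smult_l_null[of f] by simp
  show "1 \<odot>\<^sub>m f = f" using M.smult_one[of f] by simp
  show "c \<odot>\<^sub>m (d \<odot>\<^sub>m f) = (c * d) \<odot>\<^sub>m f" using M.smult_assoc1[of c d f] by simp
  show "(c + d) \<odot>\<^sub>m f = c \<odot>\<^sub>m f \<oplus>\<^sub>m d \<odot>\<^sub>m f" using M.smult_l_distr[of c d f] by simp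
  show "f \<oplus>\<^sub>m \<zero>\<^sub>m (src C f) (tgt C f) = f" using M.r_zero[of f] by simp
next
  interpret M: module scalars "Hom_module C X Y" by (rule Hom_module)
  show "c \<odot>\<^sub>m \<zero>\<^sub>m X Y = \<zero>\<^sub>m X Y" using M.smult_r_null[of c] by simp
qed

lemma comp_scale [simp]: "tgt C f = src C g \<Longrightarrow> g \<cdot> (c \<odot>\<^sub>m f) = c \<odot>\<^sub>m (g \<cdot> f)"
  and scale_comp [simp]: "tgt C f = src C g \<Longrightarrow> (c \<odot>\<^sub>m g) \<cdot> f = c \<odot>\<^sub>m (g \<cdot> f)"
  using comp_scale_left[of f "src C f" "src C g" g "tgt C g"]
    comp_scale_right[of f "src C f" "src C g" g "tgt C g"] by (simp_all add: in_Hom_iff)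

lemma comp_zero [simp]: "src C g = Y \<Longrightarrow> g \<cdot> \<zero>\<^sub>m X Y = \<zero>\<^sub>m X (tgt C g)"
  using comp_scale[of "\<zero>\<^sub>m X Y" g 0] by simp

lemma zero_comp [simp]: "tgt C f = Y \<Longrightarrow> \<zero>\<^sub>m Y Z \<cdot> f = \<zero>\<^sub>m (src C f) Z"
  using scale_comp[of f "\<zero>\<^sub>m Y Z" 0] by simp

lemma comp_add: "src C f = src C g \<Longrightarrow> tgt C f = src C h \<Longrightarrow> tgt C g = src C h \<Longrightarrow>
    h \<cdot> (f \<oplus>\<^sub>m g) = h \<cdot> f \<oplus>\<^sub>m h \<cdot> g"
  using comp_add_right[of f "src C g" "src C h" g h "tgt C h"] by (simp add: in_Hom_iff)

lemma add_comp: "src C g = tgt C f \<Longrightarrow> src C h = tgt C f \<Longrightarrow> tgt C g = tgt C h \<Longrightarrow>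
    (g \<oplus>\<^sub>m h) \<cdot> f = g \<cdot> f \<oplus>\<^sub>m h \<cdot> f"
  using comp_add_left[of f "src C f" "tgt C f" g "tgt C h" h] by (simp add: in_Hom_iff)

text \<open>Negation is no part of the data of a category; scaling by \<open>-1\<close> provides it, without mention of a hom-set.\<close>

definition diff :: "'m \<Rightarrow> 'm \<Rightarrow> 'm" (infixl \<open>\<ominus>\<^sub>m\<close> 65) where
  "f \<ominus>\<^sub>m g = f \<oplus>\<^sub>m (-1) \<odot>\<^sub>m g"

lemma src_diff [simp]: "src C f = src C g \<Longrightarrow> tgt C f = tgt C g \<Longrightarrow> src C (f \<ominus>\<^sub>m g) = src C g"
  and tgt_diff [simp]: "src C f = src C g \<Longrightarrow> tgt C f = tgt C g \<Longrightarrow> tgt C (f \<ominus>\<^sub>m g) = tgt C g"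
  by (simp_all add: diff_def)

lemma diff_add_cancel:
  assumes "src C f = src C g" "tgt C f = tgt C g"
  shows "(f \<ominus>\<^sub>m g) \<oplus>\<^sub>m g = f"
proof -
  interpret M: module scalars "Hom_module C (src C g) (tgt C g)" by (rule Hom_module)
  have "(f \<ominus>\<^sub>m g) \<oplus>\<^sub>m g = f \<oplus>\<^sub>m ((-1) \<odot>\<^sub>m g \<oplus>\<^sub>m 1 \<odot>\<^sub>m g)"
    using M.a_assoc[of f "(-1) \<odot>\<^sub>m g" g] assms by (simp add: diff_def in_Hom_iff)
  also have "(-1) \<odot>\<^sub>m g \<oplus>\<^sub>m 1 \<odot>\<^sub>m g = \<zero>\<^sub>m (src C f) (tgt C f)"
    using assms by (simp only: scale_add_left[symmetric]) simp
  finally show ?thesis by (simp only: add_zero)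
qed

lemma diff_eq_zero_iff:
  assumes "src C f = src C g" "tgt C f = tgt C g"
  shows "f \<ominus>\<^sub>m g = \<zero>\<^sub>m (src C g) (tgt C g) \<longleftrightarrow> f = g"
proof
  interpret M: module scalars "Hom_module C (src C g) (tgt C g)" by (rule Hom_module)
  assume "f \<ominus>\<^sub>m g = \<zero>\<^sub>m (src C g) (tgt C g)"
  thus "f = g" using diff_add_cancel[OF assms] M.l_zero[of g] by simp
next
  assume "f = g"
  have "1 \<odot>\<^sub>m g \<oplus>\<^sub>m (-1) \<odot>\<^sub>m g = \<zero>\<^sub>m (src C g) (tgt C g)"
    by (simp only: scale_add_left[symmetric]) simp
  thus "f \<ominus>\<^sub>m g = \<zero>\<^sub>m (src C g) (tgt C g)" using \<open>f = g\<close> by (simp add: diff_def)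
qed

lemma comp_diff: "src C f = src C g \<Longrightarrow> tgt C f = src C h \<Longrightarrow> tgt C g = src C h \<Longrightarrow>
    h \<cdot> (f \<ominus>\<^sub>m g) = h \<cdot> f \<ominus>\<^sub>m h \<cdot> g"
  unfolding diff_def by (simp add: comp_add)

lemma diff_comp: "src C g = tgt C f \<Longrightarrow> src C h = tgt C f \<Longrightarrow> tgt C g = tgt C h \<Longrightarrow>
    (g \<ominus>\<^sub>m h) \<cdot> f = g \<cdot> f \<ominus>\<^sub>m h \<cdot> f"
  unfolding diff_def by (simp add: add_comp)

lemma monicI:
  assumes "\<And>g. tgt C g = src C f \<Longrightarrow> f \<cdot> g = \<zero>\<^sub>m (src C g) (tgt C f) \<Longrightarrow> g = \<zero>\<^sub>m (src C g) (src C f)"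
  shows "monic C f"
  unfolding monic_def
proof (intro allI ballI impI)
  fix Z g h assume gh: "g \<in> Hom C Z (src C f)" "h \<in> Hom C Z (src C f)" "f \<cdot> g = f \<cdot> h"
  hence t: "src C g = src C h" "tgt C g = src C f" "tgt C h = src C f" by (auto simp: in_Hom_iff)
  have "f \<cdot> (g \<ominus>\<^sub>m h) = \<zero>\<^sub>m (src C (f \<cdot> h)) (tgt C (f \<cdot> h))"
    using t gh(3) diff_eq_zero_iff[of "f \<cdot> g" "f \<cdot> h"] by (simp add: comp_diff)
  hence "g \<ominus>\<^sub>m h = \<zero>\<^sub>m (src C h) (tgt C h)" using assms[of "g \<ominus>\<^sub>m h"] t by simp
  thus "g = h" using diff_eq_zero_iff[of g h] t by simp
qed

lemma epicI:
  assumes "\<And>g. src C g = tgt C f \<Longrightarrow> g \<cdot> f = \<zero>\<^sub>m (src C f) (tgt C g) \<Longrightarrow> g = \<zero>\<^sub>m (tgt C f) (tgt C g)"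
  shows "epic C f"
  unfolding epic_def
proof (intro allI ballI impI)
  fix Z g h assume gh: "g \<in> Hom C (tgt C f) Z" "h \<in> Hom C (tgt C f) Z" "g \<cdot> f = h \<cdot> f"
  hence t: "tgt C g = tgt C h" "src C g = tgt C f" "src C h = tgt C f" by (auto simp: in_Hom_iff)
  have "(g \<ominus>\<^sub>m h) \<cdot> f = \<zero>\<^sub>m (src C (h \<cdot> f)) (tgt C (h \<cdot> f))"
    using t gh(3) diff_eq_zero_iff[of "g \<cdot> f" "h \<cdot> f"] by (simp add: diff_comp)
  hence "g \<ominus>\<^sub>m h = \<zero>\<^sub>m (src C h) (tgt C h)" using assms[of "g \<ominus>\<^sub>m h"] t by simp
  thus "g = h" using diff_eq_zero_iff[of g h] t by simp
qed

lemma monic_cancel: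
  "monic C f \<Longrightarrow> tgt C g = src C f \<Longrightarrow> tgt C h = src C f \<Longrightarrow> src C g = src C h \<Longrightarrow> f \<cdot> g = f \<cdot> h \<Longrightarrow> g = h"
  unfolding monic_def Hom_def by fastforce

lemma epic_cancel:
  "epic C f \<Longrightarrow> src C g = tgt C f \<Longrightarrow> src C h = tgt C f \<Longrightarrow> tgt C g = tgt C h \<Longrightarrow> g \<cdot> f = h \<cdot> f \<Longrightarrow> g = h"
  unfolding epic_def Hom_def by fastforce

lemma kernel_of_ex1:
  assumes "kernel_of C f k" "tgt C h = src C f" "f \<cdot> h = \<zero>\<^sub>m (src C h) (tgt C f)"
  shows "\<exists>!u. src C u = src C h \<and> tgt C u = src C k \<and> k \<cdot> u = h"
proof -
  have "\<forall>h'\<in>Hom C (src C h) (src C f). f \<cdot> h' = \<zero>\<^sub>m (src C h) (tgt C f) \<longrightarrow>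
      (\<exists>!u. u \<in> Hom C (src C h) (src C k) \<and> k \<cdot> u = h')"
    using assms(1)[unfolded kernel_of_def, THEN conjunct2, THEN conjunct2, THEN spec[of _ "src C h"]] .
  from bspec[OF this, of h] show ?thesis using assms(2,3) by (simp add: in_Hom_iff conj_assoc)
qed

lemma cokernel_of_ex1:
  assumes "cokernel_of C f c" "src C h = tgt C f" "h \<cdot> f = \<zero>\<^sub>m (src C f) (tgt C h)"
  shows "\<exists>!u. src C u = tgt C c \<and> tgt C u = tgt C h \<and> u \<cdot> c = h"
proof -
  have "\<forall>h'\<in>Hom C (tgt C f) (tgt C h). h' \<cdot> f = \<zero>\<^sub>m (src C f) (tgt C h) \<longrightarrow>
      (\<exists>!u. u \<in> Hom C (tgt C c) (tgt C h) \<and> u \<cdot> c = h')"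
    using assms(1)[unfolded cokernel_of_def, THEN conjunct2, THEN conjunct2, THEN spec[of _ "tgt C h"]] .
  from bspec[OF this, of h] show ?thesis using assms(2,3) by (simp add: in_Hom_iff conj_assoc)
qed

lemma kernel_ofD:
  assumes "kernel_of C f k"
  shows "tgt C k = src C f" "f \<cdot> k = \<zero>\<^sub>m (src C k) (tgt C f)"
  using assms by (simp_all add: kernel_of_def)

lemma cokernel_ofD:
  assumes "cokernel_of C f c"
  shows "src C c = tgt C f" "c \<cdot> f = \<zero>\<^sub>m (src C f) (tgt C c)"
  using assms by (simp_all add: cokernel_of_def)

lemma kernel_imp_monic:
  assumes "kernel_of C f k"
  shows "monic C k"
proof (rule monicI)
  fix g assume g: "tgt C g = src C k" "k \<cdot> g = \<zero>\<^sub>m (src C g) (tgt C k)"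
  note k = kernel_ofD[OF assms]
  have "\<exists>!u. src C u = src C g \<and> tgt C u = src C k \<and> k \<cdot> u = \<zero>\<^sub>m (src C g) (src C f)"
    using kernel_of_ex1[OF assms, of "\<zero>\<^sub>m (src C g) (src C f)"] by simp
  moreover have "k \<cdot> \<zero>\<^sub>m (src C g) (src C k) = \<zero>\<^sub>m (src C g) (src C f)" using k by simp
  ultimately show "g = \<zero>\<^sub>m (src C g) (src C k)" using g k by (metis src_zero tgt_zero)
qed

lemma cokernel_imp_epic:
  assumes "cokernel_of C f c"
  shows "epic C c"
proof (rule epicI)
  fix g assume g: "src C g = tgt C c" "g \<cdot> c = \<zero>\<^sub>m (src C c) (tgt C g)"
  note c = cokernel_ofD[OF assms]
  have "\<exists>!u. src C u = tgt C c \<and> tgt C u = tgt C g \<and> u \<cdot> c = \<zero>\<^sub>m (tgt C f) (tgt C g)"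
    using cokernel_of_ex1[OF assms, of "\<zero>\<^sub>m (tgt C f) (tgt C g)"] by simp
  moreover have "\<zero>\<^sub>m (tgt C c) (tgt C g) \<cdot> c = \<zero>\<^sub>m (tgt C f) (tgt C g)" using c by simp
  ultimately show "g = \<zero>\<^sub>m (tgt C c) (tgt C g)" using g c by (metis src_zero tgt_zero)
qed

lemma zero_object_iff: "zero_object C Z \<longleftrightarrow> \<iota> Z = \<zero>\<^sub>m Z Z"
proof
  assume "zero_object C Z"
  thus "\<iota> Z = \<zero>\<^sub>m Z Z" unfolding zero_object_def by (auto simp: in_Hom_iff) (metis src_id tgt_id src_zero tgt_zero)
next
  assume z: "\<iota> Z = \<zero>\<^sub>m Z Z"
  have "f = \<zero>\<^sub>m Z X" if "src C f = Z" "tgt C f = X" for f X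
    using comp_id[of f Z] that z by simp
  moreover have "f = \<zero>\<^sub>m X Z" if "src C f = X" "tgt C f = Z" for f X
    using id_comp[of f Z] that z by simp
  ultimately show "zero_object C Z" unfolding zero_object_def in_Hom_iff
    by (metis src_zero tgt_zero)
qed

lemma simple_not_zero: "simple_object C X \<Longrightarrow> \<iota> X \<noteq> \<zero>\<^sub>m X X"
  by (simp add: simple_object_def zero_object_iff)

lemma epic_to_simple_nonzero:
  assumes "epic C f" "simple_object C (tgt C f)"
  shows "f \<noteq> \<zero>\<^sub>m (src C f) (tgt C f)"
proof
  assume f: "f = \<zero>\<^sub>m (src C f) (tgt C f)"
  have "\<iota> (tgt C f) \<cdot> f = \<zero>\<^sub>m (tgt C f) (tgt C f) \<cdot> f" using f by simp
  hence "\<iota> (tgt C f) = \<zero>\<^sub>m (tgt C f) (tgt C f)" by (rule epic_cancel[OF assms(1), rotated -1]) simp_all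
  thus False using simple_not_zero[OF assms(2)] by simp
qed

lemma monic_from_simple_nonzero:
  assumes "monic C f" "simple_object C (src C f)"
  shows "f \<noteq> \<zero>\<^sub>m (src C f) (tgt C f)"
proof
  assume f: "f = \<zero>\<^sub>m (src C f) (tgt C f)"
  have "f \<cdot> \<iota> (src C f) = f \<cdot> \<zero>\<^sub>m (src C f) (src C f)" using f by simp
  hence "\<iota> (src C f) = \<zero>\<^sub>m (src C f) (src C f)" by (rule monic_cancel[OF assms(1), rotated -1]) simp_all
  thus False using simple_not_zero[OF assms(2)] by simp
qed

lemma factor_through_kernel:
  assumes "kernel_of C f k" "tgt C h = src C f" "f \<cdot> h = \<zero>\<^sub>m (src C h) (tgt C f)"
  obtains u where "src C u = src C h" "tgt C u = src C k" "k \<cdot> u = h"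
  using kernel_of_ex1[OF assms] by blast

lemma factor_through_cokernel:
  assumes "cokernel_of C f c" "src C h = tgt C f" "h \<cdot> f = \<zero>\<^sub>m (src C f) (tgt C h)"
  obtains u where "src C u = tgt C c" "tgt C u = tgt C h" "u \<cdot> c = h"
  using cokernel_of_ex1[OF assms] by blast

end


locale abelian_linear_category = linear_category +
  assumes abelian: "abelian_category C"
begin

text \<open>The kernel of \<open>f\<close> is a proper subobject of a simple object, hence zero.\<close>

lemma monic_from_simple:
  assumes "simple_object C (src C f)" "f \<noteq> \<zero>\<^sub>m (src C f) (tgt C f)"
  shows "monic C f"
proof -
  obtain k where k: "kernel_of C f k" using abelian unfolding abelian_category_def by blast
  note tk = kernel_ofD[OF k]
  have "\<not> isomorphism C k"
  proof
    assume "isomorphism C k"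
    then obtain g where g: "src C g = tgt C k" "tgt C g = src C k" "k \<cdot> g = \<iota> (tgt C k)"
      by (auto simp: isomorphism_def in_Hom_iff)
    have "f = (f \<cdot> k) \<cdot> g" using g tk(1) by (subst assoc) auto
    also have "\<dots> = \<zero>\<^sub>m (src C f) (tgt C f)" using g tk by simp
    finally show False using assms(2) by simp
  qed
  moreover have "k \<in> Hom C (src C k) (src C f)" using tk by (simp add: in_Hom_iff)
  ultimately have z: "\<iota> (src C k) = \<zero>\<^sub>m (src C k) (src C k)"
    using assms(1) kernel_imp_monic[OF k] unfolding simple_object_def zero_object_iff by blast
  show ?thesis
  proof (rule monicI)
    fix g assume g: "tgt C g = src C f" "f \<cdot> g = \<zero>\<^sub>m (src C g) (tgt C f)"
    obtain u where u: "src C u = src C g" "tgt C u = src C k" "k \<cdot> u = g"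
      using factor_through_kernel[OF k g] by blast
    have "u = \<zero>\<^sub>m (src C g) (src C k)" using id_comp[of u "src C k"] u z by simp
    thus "g = \<zero>\<^sub>m (src C g) (src C f)" using u tk by simp
  qed
qed

text \<open>The cokernel map of \<open>f\<close> starts at a simple object, so if it were nonzero it would be monic, and
  \<open>f\<close> would vanish.\<close>

lemma epic_to_simple:
  assumes "simple_object C (tgt C f)" "f \<noteq> \<zero>\<^sub>m (src C f) (tgt C f)"
  shows "epic C f"
proof -
  obtain c where c: "cokernel_of C f c" using abelian unfolding abelian_category_def by blast
  note tc = cokernel_ofD[OF c]
  have c0: "c = \<zero>\<^sub>m (src C c) (tgt C c)"
  proof (rule ccontr)
    assume "c \<noteq> \<zero>\<^sub>m (src C c) (tgt C c)"
    hence "monic C c" using monic_from_simple assms(1) tc by simp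
    hence "f = \<zero>\<^sub>m (src C f) (tgt C f)" using monic_cancel[of c f "\<zero>\<^sub>m (src C f) (tgt C f)"] tc by simp
    thus False using assms(2) by simp
  qed
  show ?thesis
  proof (rule epicI)
    fix g assume g: "src C g = tgt C f" "g \<cdot> f = \<zero>\<^sub>m (src C f) (tgt C g)"
    obtain u where u: "src C u = tgt C c" "tgt C u = tgt C g" "u \<cdot> c = g"
      using factor_through_cokernel[OF c g] by blast
    thus "g = \<zero>\<^sub>m (tgt C f) (tgt C g)" using c0 tc comp_zero[of u "tgt C c" "src C c"] by metis
  qed
qed

text \<open>A monomorphism \<open>i\<close> is the kernel of some \<open>g\<close>, and \<open>g\<close> factors through the cokernel of \<open>i\<close>, of which
  \<open>i\<close> is therefore a kernel as well.\<close>

lemma monic_is_kernel_of_epic: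
  assumes "monic C i"
  obtains c where "kernel_of C c i" "epic C c"
proof -
  obtain g where g: "kernel_of C g i" using abelian assms unfolding abelian_category_def by blast
  note tg = kernel_ofD[OF g]
  obtain c where c: "cokernel_of C i c" using abelian unfolding abelian_category_def by blast
  note tc = cokernel_ofD[OF c]
  have "g \<cdot> i = \<zero>\<^sub>m (src C i) (tgt C g)" "src C g = tgt C i" using tg by simp_all
  then obtain u where u: "src C u = tgt C c" "tgt C u = tgt C g" "u \<cdot> c = g"
    using factor_through_cokernel[OF c] by blast
  have "\<exists>!v. v \<in> Hom C Z (src C i) \<and> i \<cdot> v = h"
    if h: "h \<in> Hom C Z (src C c)" "c \<cdot> h = \<zero>\<^sub>m Z (tgt C c)" for Z h
  proof -
    have th: "src C h = Z" "tgt C h = src C c" using h(1) by (simp_all add: in_Hom_iff)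
    have "g \<cdot> h = u \<cdot> (c \<cdot> h)" unfolding u(3)[symmetric] using u th by (subst assoc) auto
    also have "\<dots> = \<zero>\<^sub>m Z (tgt C g)" using u h(2) by simp
    finally have "\<exists>!v. src C v = src C h \<and> tgt C v = src C i \<and> i \<cdot> v = h"
      using th tc tg by (intro kernel_of_ex1[OF g]) simp_all
    thus ?thesis using th by (simp add: in_Hom_iff conj_assoc)
  qed
  hence "kernel_of C c i" using tc unfolding kernel_of_def by simp
  thus thesis using that cokernel_imp_epic[OF c] by blast
qed

end


section \<open>Dual pairs and their adjunctions\<close>

context tensor_category
begin

lemma src_tensor [simp]: "src C (f \<boxtimes>\<^sub>m g) = src C f \<boxtimes> src C g"
  and tgt_tensor [simp]: "tgt C (f \<boxtimes>\<^sub>m g) = tgt C f \<boxtimes> tgt C g"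
  using tensor_in_Hom[of f "src C f" "tgt C f" g "src C g" "tgt C g"] by (simp_all add: in_Hom_iff)

lemmas [simp] = tensor_obj_assoc unit_obj_left unit_obj_right unit_mor_left unit_mor_right
  tensor_mor_assoc tensor_id tensor_scale_left tensor_scale_right

lemma tensor_comp: "tgt C f = src C g \<Longrightarrow> tgt C f' = src C g' \<Longrightarrow>
    (g \<boxtimes>\<^sub>m g') \<cdot> (f \<boxtimes>\<^sub>m f') = (g \<cdot> f) \<boxtimes>\<^sub>m (g' \<cdot> f')"
  using interchange[of f "src C f" "src C g" g "tgt C g" f' "src C f'" "src C g'" g' "tgt C g'"]
  by (simp add: in_Hom_iff)

lemma zero_tensor [simp]: "\<zero>\<^sub>m X Y \<boxtimes>\<^sub>m g = \<zero>\<^sub>m (X \<boxtimes> src C g) (Y \<boxtimes> tgt C g)"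
  using tensor_scale_left[of 0 "\<zero>\<^sub>m X Y" g] by (simp del: tensor_scale_left)

lemma whisker_right: "tgt C f = src C g \<Longrightarrow> (g \<cdot> f) \<boxtimes>\<^sub>m \<iota> A = (g \<boxtimes>\<^sub>m \<iota> A) \<cdot> (f \<boxtimes>\<^sub>m \<iota> A)"
  by (simp add: tensor_comp)

lemma whisker_left: "tgt C f = src C g \<Longrightarrow> \<iota> A \<boxtimes>\<^sub>m (g \<cdot> f) = (\<iota> A \<boxtimes>\<^sub>m g) \<cdot> (\<iota> A \<boxtimes>\<^sub>m f)"
  by (simp add: tensor_comp)

text \<open>Morphisms in different tensor factors commute.\<close>

lemma slide: "src C f = X \<Longrightarrow> tgt C f = Y \<Longrightarrow> src C g = A \<Longrightarrow> tgt C g = B \<Longrightarrow>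
    (\<iota> Y \<boxtimes>\<^sub>m g) \<cdot> (f \<boxtimes>\<^sub>m \<iota> A) = (f \<boxtimes>\<^sub>m \<iota> B) \<cdot> (\<iota> X \<boxtimes>\<^sub>m g)"
  by (simp add: tensor_comp)

lemma id_tensor: "\<iota> (X \<boxtimes> Y) \<boxtimes>\<^sub>m f = \<iota> X \<boxtimes>\<^sub>m \<iota> Y \<boxtimes>\<^sub>m f"
  using tensor_mor_assoc[of "\<iota> X" "\<iota> Y" f] by (simp del: tensor_mor_assoc)

end

text \<open>An object \<open>A\<close> with left dual \<open>B\<close>. In a pivotal category both \<open>(V, V\<^sup>\<star>)\<close> and \<open>(V\<^sup>\<star>, V)\<close> are of this kind,
  so what holds for such pairs holds for \<open>V\<close> and \<open>V\<^sup>\<star>\<close> in either role.\<close>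

locale exact_pairing = tensor_category C
  for C :: "('o, 'm, 'k::comm_ring_1) tensor_data" (structure) +
  fixes A B :: 'o and c e :: 'm
  assumes coeval: "src C c = \<bbbone>" "tgt C c = A \<boxtimes> B"
    and eval: "src C e = B \<boxtimes> A" "tgt C e = \<bbbone>"
    and zigzag_left: "(\<iota> A \<boxtimes>\<^sub>m e) \<cdot> (c \<boxtimes>\<^sub>m \<iota> A) = \<iota> A"
    and zigzag_right: "(e \<boxtimes>\<^sub>m \<iota> B) \<cdot> (\<iota> B \<boxtimes>\<^sub>m c) = \<iota> B"
begin

lemmas [simp] = coeval eval

text \<open>The bijections \<open>Hom (X \<boxtimes> A) Y \<cong> Hom X (Y \<boxtimes> B)\<close> and \<open>Hom (B \<boxtimes> X) Y \<cong> Hom X (A \<boxtimes> Y)\<close>. The object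
  has to be given since a tensor product does not determine its factors.\<close>

definition "curry_right X f = (f \<boxtimes>\<^sub>m \<iota> B) \<cdot> (\<iota> X \<boxtimes>\<^sub>m c)"

definition "uncurry_right Y h = (\<iota> Y \<boxtimes>\<^sub>m e) \<cdot> (h \<boxtimes>\<^sub>m \<iota> A)"

definition "curry_left X f = (\<iota> A \<boxtimes>\<^sub>m f) \<cdot> (c \<boxtimes>\<^sub>m \<iota> X)"

definition "uncurry_left Y h = (e \<boxtimes>\<^sub>m \<iota> Y) \<cdot> (\<iota> B \<boxtimes>\<^sub>m h)"

lemma src_curry_right [simp]: "src C f = X \<boxtimes> A \<Longrightarrow> src C (curry_right X f) = X"
  and tgt_curry_right [simp]: "src C f = X \<boxtimes> A \<Longrightarrow> tgt C (curry_right X f) = tgt C f \<boxtimes> B"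
  by (simp_all add: curry_right_def)

lemma src_uncurry_right [simp]: "tgt C h = Y \<boxtimes> B \<Longrightarrow> src C (uncurry_right Y h) = src C h \<boxtimes> A"
  and tgt_uncurry_right [simp]: "tgt C h = Y \<boxtimes> B \<Longrightarrow> tgt C (uncurry_right Y h) = Y"
  by (simp_all add: uncurry_right_def)

lemma src_curry_left [simp]: "src C f = B \<boxtimes> X \<Longrightarrow> src C (curry_left X f) = X"
  and tgt_curry_left [simp]: "src C f = B \<boxtimes> X \<Longrightarrow> tgt C (curry_left X f) = A \<boxtimes> tgt C f"
  by (simp_all add: curry_left_def)

lemma src_uncurry_left [simp]: "tgt C h = A \<boxtimes> Y \<Longrightarrow> src C (uncurry_left Y h) = B \<boxtimes> src C h"
  and tgt_uncurry_left [simp]: "tgt C h = A \<boxtimes> Y \<Longrightarrow> tgt C (uncurry_left Y h) = Y"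
  by (simp_all add: uncurry_left_def)

lemma uncurry_curry_right:
  assumes f: "src C f = X \<boxtimes> A"
  shows "uncurry_right (tgt C f) (curry_right X f) = f"
proof -
  have "uncurry_right (tgt C f) (curry_right X f) =
      (\<iota> (tgt C f) \<boxtimes>\<^sub>m e) \<cdot> ((f \<boxtimes>\<^sub>m \<iota> (B \<boxtimes> A)) \<cdot> (\<iota> X \<boxtimes>\<^sub>m c \<boxtimes>\<^sub>m \<iota> A))"
    unfolding uncurry_right_def curry_right_def by (subst whisker_right) (simp_all add: f)
  also have "\<dots> = ((\<iota> (tgt C f) \<boxtimes>\<^sub>m e) \<cdot> (f \<boxtimes>\<^sub>m \<iota> (B \<boxtimes> A))) \<cdot> (\<iota> X \<boxtimes>\<^sub>m c \<boxtimes>\<^sub>m \<iota> A)"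
    by (rule assoc[symmetric]) (simp_all add: f)
  also have "(\<iota> (tgt C f) \<boxtimes>\<^sub>m e) \<cdot> (f \<boxtimes>\<^sub>m \<iota> (B \<boxtimes> A)) = f \<cdot> (\<iota> X \<boxtimes>\<^sub>m \<iota> A \<boxtimes>\<^sub>m e)"
    using slide[of f "X \<boxtimes> A" "tgt C f" e "B \<boxtimes> A" \<bbbone>] f by (simp add: id_tensor)
  also have "(f \<cdot> (\<iota> X \<boxtimes>\<^sub>m \<iota> A \<boxtimes>\<^sub>m e)) \<cdot> (\<iota> X \<boxtimes>\<^sub>m c \<boxtimes>\<^sub>m \<iota> A) =
      f \<cdot> ((\<iota> X \<boxtimes>\<^sub>m \<iota> A \<boxtimes>\<^sub>m e) \<cdot> (\<iota> X \<boxtimes>\<^sub>m c \<boxtimes>\<^sub>m \<iota> A))"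
    by (rule assoc) (simp_all add: f)
  also have "(\<iota> X \<boxtimes>\<^sub>m \<iota> A \<boxtimes>\<^sub>m e) \<cdot> (\<iota> X \<boxtimes>\<^sub>m c \<boxtimes>\<^sub>m \<iota> A) = \<iota> (X \<boxtimes> A)"
    by (subst whisker_left[symmetric]) (simp_all add: zigzag_left)
  finally show ?thesis using f by simp
qed

lemma curry_uncurry_right:
  assumes h: "tgt C h = Y \<boxtimes> B"
  shows "curry_right (src C h) (uncurry_right Y h) = h"
proof -
  have "curry_right (src C h) (uncurry_right Y h) =
      ((\<iota> Y \<boxtimes>\<^sub>m e \<boxtimes>\<^sub>m \<iota> B) \<cdot> (h \<boxtimes>\<^sub>m \<iota> (A \<boxtimes> B))) \<cdot> (\<iota> (src C h) \<boxtimes>\<^sub>m c)"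
    unfolding uncurry_right_def curry_right_def by (subst whisker_right) (simp_all add: h)
  also have "\<dots> = (\<iota> Y \<boxtimes>\<^sub>m e \<boxtimes>\<^sub>m \<iota> B) \<cdot> ((h \<boxtimes>\<^sub>m \<iota> (A \<boxtimes> B)) \<cdot> (\<iota> (src C h) \<boxtimes>\<^sub>m c))"
    by (rule assoc) (simp_all add: h)
  also have "(h \<boxtimes>\<^sub>m \<iota> (A \<boxtimes> B)) \<cdot> (\<iota> (src C h) \<boxtimes>\<^sub>m c) = (\<iota> Y \<boxtimes>\<^sub>m \<iota> B \<boxtimes>\<^sub>m c) \<cdot> h"
    using slide[of h "src C h" "Y \<boxtimes> B" c \<bbbone> "A \<boxtimes> B"] h by (simp add: id_tensor)
  also have "(\<iota> Y \<boxtimes>\<^sub>m e \<boxtimes>\<^sub>m \<iota> B) \<cdot> ((\<iota> Y \<boxtimes>\<^sub>m \<iota> B \<boxtimes>\<^sub>m c) \<cdot> h) =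
      ((\<iota> Y \<boxtimes>\<^sub>m e \<boxtimes>\<^sub>m \<iota> B) \<cdot> (\<iota> Y \<boxtimes>\<^sub>m \<iota> B \<boxtimes>\<^sub>m c)) \<cdot> h"
    by (rule assoc[symmetric]) (simp_all add: h)
  also have "(\<iota> Y \<boxtimes>\<^sub>m e \<boxtimes>\<^sub>m \<iota> B) \<cdot> (\<iota> Y \<boxtimes>\<^sub>m \<iota> B \<boxtimes>\<^sub>m c) = \<iota> (Y \<boxtimes> B)"
    by (subst whisker_left[symmetric]) (simp_all add: zigzag_right)
  finally show ?thesis using h by simp
qed

lemma uncurry_curry_left:
  assumes f: "src C f = B \<boxtimes> X"
  shows "uncurry_left (tgt C f) (curry_left X f) = f"
proof -
  have "uncurry_left (tgt C f) (curry_left X f) =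
      (e \<boxtimes>\<^sub>m \<iota> (tgt C f)) \<cdot> ((\<iota> B \<boxtimes>\<^sub>m \<iota> A \<boxtimes>\<^sub>m f) \<cdot> (\<iota> B \<boxtimes>\<^sub>m c \<boxtimes>\<^sub>m \<iota> X))"
    unfolding uncurry_left_def curry_left_def by (subst whisker_left) (simp_all add: f)
  also have "\<dots> = ((e \<boxtimes>\<^sub>m \<iota> (tgt C f)) \<cdot> (\<iota> B \<boxtimes>\<^sub>m \<iota> A \<boxtimes>\<^sub>m f)) \<cdot> (\<iota> B \<boxtimes>\<^sub>m c \<boxtimes>\<^sub>m \<iota> X)"
    by (rule assoc[symmetric]) (simp_all add: f)
  also have "(e \<boxtimes>\<^sub>m \<iota> (tgt C f)) \<cdot> (\<iota> B \<boxtimes>\<^sub>m \<iota> A \<boxtimes>\<^sub>m f) = f \<cdot> (e \<boxtimes>\<^sub>m \<iota> B \<boxtimes>\<^sub>m \<iota> X)"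
    using slide[of e "B \<boxtimes> A" \<bbbone> f "B \<boxtimes> X" "tgt C f"] f by (simp add: id_tensor)
  also have "(f \<cdot> (e \<boxtimes>\<^sub>m \<iota> B \<boxtimes>\<^sub>m \<iota> X)) \<cdot> (\<iota> B \<boxtimes>\<^sub>m c \<boxtimes>\<^sub>m \<iota> X) =
      f \<cdot> ((e \<boxtimes>\<^sub>m \<iota> B \<boxtimes>\<^sub>m \<iota> X) \<cdot> (\<iota> B \<boxtimes>\<^sub>m c \<boxtimes>\<^sub>m \<iota> X))"
    by (rule assoc) (simp_all add: f)
  also have "(e \<boxtimes>\<^sub>m \<iota> B \<boxtimes>\<^sub>m \<iota> X) \<cdot> (\<iota> B \<boxtimes>\<^sub>m c \<boxtimes>\<^sub>m \<iota> X) = \<iota> (B \<boxtimes> X)"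
    using whisker_right[of "\<iota> B \<boxtimes>\<^sub>m c" "e \<boxtimes>\<^sub>m \<iota> B" X] by (simp add: zigzag_right)
  finally show ?thesis using f by simp
qed

text \<open>Naturality of the bijections in the argument that is not fixed by the pairing. It makes
  \<open>- \<boxtimes> A\<close> and \<open>B \<boxtimes> -\<close> left adjoints, hence compatible with epimorphisms, and \<open>- \<boxtimes> B\<close> a right
  adjoint, hence compatible with monomorphisms and kernels.\<close>

lemma curry_right_whisker:
  assumes "src C f = Y \<boxtimes> A" "tgt C u = Y"
  shows "curry_right (src C u) (f \<cdot> (u \<boxtimes>\<^sub>m \<iota> A)) = curry_right Y f \<cdot> u"
proof -
  have "curry_right (src C u) (f \<cdot> (u \<boxtimes>\<^sub>m \<iota> A)) = ((f \<boxtimes>\<^sub>m \<iota> B) \<cdot> (u \<boxtimes>\<^sub>m \<iota> (A \<boxtimes> B))) \<cdot> (\<iota> (src C u) \<boxtimes>\<^sub>m c)"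
    unfolding curry_right_def using assms by (subst whisker_right) simp_all
  also have "\<dots> = (f \<boxtimes>\<^sub>m \<iota> B) \<cdot> ((u \<boxtimes>\<^sub>m \<iota> (A \<boxtimes> B)) \<cdot> (\<iota> (src C u) \<boxtimes>\<^sub>m c))"
    using assms by (intro assoc) simp_all
  also have "(u \<boxtimes>\<^sub>m \<iota> (A \<boxtimes> B)) \<cdot> (\<iota> (src C u) \<boxtimes>\<^sub>m c) = (\<iota> Y \<boxtimes>\<^sub>m c) \<cdot> u"
    using slide[of u "src C u" Y c \<bbbone> "A \<boxtimes> B"] assms by simp
  also have "(f \<boxtimes>\<^sub>m \<iota> B) \<cdot> ((\<iota> Y \<boxtimes>\<^sub>m c) \<cdot> u) = curry_right Y f \<cdot> u"
    unfolding curry_right_def using assms by (intro assoc[symmetric]) simp_all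
  finally show ?thesis .
qed

lemma uncurry_right_whisker:
  assumes "tgt C h = Y \<boxtimes> B" "src C u = Y"
  shows "uncurry_right (tgt C u) ((u \<boxtimes>\<^sub>m \<iota> B) \<cdot> h) = u \<cdot> uncurry_right Y h"
proof -
  have "uncurry_right (tgt C u) ((u \<boxtimes>\<^sub>m \<iota> B) \<cdot> h) =
      (\<iota> (tgt C u) \<boxtimes>\<^sub>m e) \<cdot> ((u \<boxtimes>\<^sub>m \<iota> (B \<boxtimes> A)) \<cdot> (h \<boxtimes>\<^sub>m \<iota> A))"
    unfolding uncurry_right_def using assms by (subst whisker_right) simp_all
  also have "\<dots> = ((\<iota> (tgt C u) \<boxtimes>\<^sub>m e) \<cdot> (u \<boxtimes>\<^sub>m \<iota> (B \<boxtimes> A))) \<cdot> (h \<boxtimes>\<^sub>m \<iota> A)"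
    using assms by (intro assoc[symmetric]) simp_all
  also have "(\<iota> (tgt C u) \<boxtimes>\<^sub>m e) \<cdot> (u \<boxtimes>\<^sub>m \<iota> (B \<boxtimes> A)) = u \<cdot> (\<iota> Y \<boxtimes>\<^sub>m e)"
    using slide[of u Y "tgt C u" e "B \<boxtimes> A" \<bbbone>] assms by simp
  also have "(u \<cdot> (\<iota> Y \<boxtimes>\<^sub>m e)) \<cdot> (h \<boxtimes>\<^sub>m \<iota> A) = u \<cdot> uncurry_right Y h"
    unfolding uncurry_right_def using assms by (intro assoc) simp_all
  finally show ?thesis .
qed

lemma curry_left_whisker:
  assumes "src C f = B \<boxtimes> Y" "tgt C u = Y"
  shows "curry_left (src C u) (f \<cdot> (\<iota> B \<boxtimes>\<^sub>m u)) = curry_left Y f \<cdot> u"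
proof -
  have "curry_left (src C u) (f \<cdot> (\<iota> B \<boxtimes>\<^sub>m u)) =
      ((\<iota> A \<boxtimes>\<^sub>m f) \<cdot> (\<iota> A \<boxtimes>\<^sub>m \<iota> B \<boxtimes>\<^sub>m u)) \<cdot> (c \<boxtimes>\<^sub>m \<iota> (src C u))"
    unfolding curry_left_def using assms by (subst whisker_left) simp_all
  also have "\<dots> = (\<iota> A \<boxtimes>\<^sub>m f) \<cdot> ((\<iota> A \<boxtimes>\<^sub>m \<iota> B \<boxtimes>\<^sub>m u) \<cdot> (c \<boxtimes>\<^sub>m \<iota> (src C u)))"
    using assms by (intro assoc) simp_all
  also have "(\<iota> A \<boxtimes>\<^sub>m \<iota> B \<boxtimes>\<^sub>m u) \<cdot> (c \<boxtimes>\<^sub>m \<iota> (src C u)) = (c \<boxtimes>\<^sub>m \<iota> Y) \<cdot> u"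
    using slide[of c \<bbbone> "A \<boxtimes> B" u "src C u" Y] assms by (simp add: id_tensor)
  also have "(\<iota> A \<boxtimes>\<^sub>m f) \<cdot> ((c \<boxtimes>\<^sub>m \<iota> Y) \<cdot> u) = curry_left Y f \<cdot> u"
    unfolding curry_left_def using assms by (intro assoc[symmetric]) simp_all
  finally show ?thesis .
qed

lemma uncurry_left_whisker:
  assumes "tgt C h = A \<boxtimes> Y" "src C u = Y"
  shows "uncurry_left (tgt C u) ((\<iota> A \<boxtimes>\<^sub>m u) \<cdot> h) = u \<cdot> uncurry_left Y h"
proof -
  have "uncurry_left (tgt C u) ((\<iota> A \<boxtimes>\<^sub>m u) \<cdot> h) =
      (e \<boxtimes>\<^sub>m \<iota> (tgt C u)) \<cdot> ((\<iota> B \<boxtimes>\<^sub>m \<iota> A \<boxtimes>\<^sub>m u) \<cdot> (\<iota> B \<boxtimes>\<^sub>m h))"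
    unfolding uncurry_left_def using assms by (subst whisker_left) simp_all
  also have "\<dots> = ((e \<boxtimes>\<^sub>m \<iota> (tgt C u)) \<cdot> (\<iota> B \<boxtimes>\<^sub>m \<iota> A \<boxtimes>\<^sub>m u)) \<cdot> (\<iota> B \<boxtimes>\<^sub>m h)"
    using assms by (intro assoc[symmetric]) simp_all
  also have "(e \<boxtimes>\<^sub>m \<iota> (tgt C u)) \<cdot> (\<iota> B \<boxtimes>\<^sub>m \<iota> A \<boxtimes>\<^sub>m u) = u \<cdot> (e \<boxtimes>\<^sub>m \<iota> Y)"
    using slide[of e "B \<boxtimes> A" \<bbbone> u Y "tgt C u"] assms by (simp add: id_tensor)
  also have "(u \<cdot> (e \<boxtimes>\<^sub>m \<iota> Y)) \<cdot> (\<iota> B \<boxtimes>\<^sub>m h) = u \<cdot> uncurry_left Y h"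
    unfolding uncurry_left_def using assms by (intro assoc) simp_all
  finally show ?thesis .
qed

lemma tensor_right_epic:
  assumes "epic C u"
  shows "epic C (u \<boxtimes>\<^sub>m \<iota> A)"
  unfolding epic_def
proof (intro allI ballI impI)
  fix Z g h assume gh: "g \<in> Hom C (tgt C (u \<boxtimes>\<^sub>m \<iota> A)) Z" "h \<in> Hom C (tgt C (u \<boxtimes>\<^sub>m \<iota> A)) Z"
    "g \<cdot> (u \<boxtimes>\<^sub>m \<iota> A) = h \<cdot> (u \<boxtimes>\<^sub>m \<iota> A)"
  hence t: "src C g = tgt C u \<boxtimes> A" "src C h = tgt C u \<boxtimes> A" "tgt C g = Z" "tgt C h = Z"
    by (simp_all add: in_Hom_iff)
  have "curry_right (tgt C u) g \<cdot> u = curry_right (tgt C u) h \<cdot> u"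
    using t gh(3) curry_right_whisker[of _ "tgt C u" u] by metis
  hence "curry_right (tgt C u) g = curry_right (tgt C u) h"
    by (rule epic_cancel[OF assms, rotated -1]) (simp_all add: t)
  thus "g = h" using uncurry_curry_right[of g "tgt C u"] uncurry_curry_right[of h "tgt C u"] t by simp
qed

lemma tensor_left_epic:
  assumes "epic C u"
  shows "epic C (\<iota> B \<boxtimes>\<^sub>m u)"
  unfolding epic_def
proof (intro allI ballI impI)
  fix Z g h assume gh: "g \<in> Hom C (tgt C (\<iota> B \<boxtimes>\<^sub>m u)) Z" "h \<in> Hom C (tgt C (\<iota> B \<boxtimes>\<^sub>m u)) Z"
    "g \<cdot> (\<iota> B \<boxtimes>\<^sub>m u) = h \<cdot> (\<iota> B \<boxtimes>\<^sub>m u)"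
  hence t: "src C g = B \<boxtimes> tgt C u" "src C h = B \<boxtimes> tgt C u" "tgt C g = Z" "tgt C h = Z"
    by (simp_all add: in_Hom_iff)
  have "curry_left (tgt C u) g \<cdot> u = curry_left (tgt C u) h \<cdot> u"
    using t gh(3) curry_left_whisker[of _ "tgt C u" u] by metis
  hence "curry_left (tgt C u) g = curry_left (tgt C u) h"
    by (rule epic_cancel[OF assms, rotated -1]) (simp_all add: t)
  thus "g = h" using uncurry_curry_left[of g "tgt C u"] uncurry_curry_left[of h "tgt C u"] t by simp
qed

text \<open>The existence half of the statement that \<open>- \<boxtimes> B\<close> preserves kernels.\<close>

lemma tensor_right_factor:
  assumes k: "kernel_of C u k" and h: "tgt C h = src C u \<boxtimes> B"
    and z: "(u \<boxtimes>\<^sub>m \<iota> B) \<cdot> h = \<zero>\<^sub>m (src C h) (tgt C u \<boxtimes> B)"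
  obtains v where "src C v = src C h" "tgt C v = src C k \<boxtimes> B" "(k \<boxtimes>\<^sub>m \<iota> B) \<cdot> v = h"
proof -
  note tk = kernel_ofD[OF k]
  have "u \<cdot> uncurry_right (src C u) h = uncurry_right (tgt C u) (\<zero>\<^sub>m (src C h) (tgt C u \<boxtimes> B))"
    using uncurry_right_whisker[OF h refl] z by simp
  also have "\<dots> = \<zero>\<^sub>m (src C h \<boxtimes> A) (tgt C u)" by (simp add: uncurry_right_def)
  finally obtain w where w: "src C w = src C h \<boxtimes> A" "tgt C w = src C k" "k \<cdot> w = uncurry_right (src C u) h"
    using factor_through_kernel[OF k, of "uncurry_right (src C u) h"] h by auto
  let ?v = "curry_right (src C h) w"
  have "(k \<boxtimes>\<^sub>m \<iota> B) \<cdot> ?v = curry_right (src C h) (k \<cdot> w)"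
    unfolding curry_right_def using w by (subst whisker_right) (simp_all add: assoc)
  also have "\<dots> = h" unfolding w(3) by (rule curry_uncurry_right[OF h])
  finally show thesis using that[of ?v] w by simp
qed

lemma tensor_right_monic:
  assumes "monic C u"
  shows "monic C (u \<boxtimes>\<^sub>m \<iota> B)"
  unfolding monic_def
proof (intro allI ballI impI)
  fix Z g h assume gh: "g \<in> Hom C Z (src C (u \<boxtimes>\<^sub>m \<iota> B))" "h \<in> Hom C Z (src C (u \<boxtimes>\<^sub>m \<iota> B))"
    "(u \<boxtimes>\<^sub>m \<iota> B) \<cdot> g = (u \<boxtimes>\<^sub>m \<iota> B) \<cdot> h"
  hence t: "tgt C g = src C u \<boxtimes> B" "tgt C h = src C u \<boxtimes> B" "src C g = Z" "src C h = Z"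
    by (simp_all add: in_Hom_iff)
  have "u \<cdot> uncurry_right (src C u) g = u \<cdot> uncurry_right (src C u) h"
    using t gh(3) uncurry_right_whisker[of _ "src C u" u] by metis
  hence "uncurry_right (src C u) g = uncurry_right (src C u) h"
    by (rule monic_cancel[OF assms, rotated -1]) (simp_all add: t)
  thus "g = h" using curry_uncurry_right[of g "src C u"] curry_uncurry_right[of h "src C u"] t by simp
qed

end


section \<open>Projective objects\<close>

context linear_category
begin

lemma projective_lift:
  assumes "projective C P" "epic C e" "src C f = P" "tgt C f = tgt C e"
  obtains g where "src C g = P" "tgt C g = src C e" "e \<cdot> g = f"
proof -
  have "e \<in> Hom C (src C e) (tgt C e)" "f \<in> Hom C P (tgt C e)" using assms by (simp_all add: in_Hom_iff)
  hence "\<exists>g\<in>Hom C P (src C e). e \<cdot> g = f" using assms(1,2) unfolding projective_def by blast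
  thus thesis using that by (auto simp: in_Hom_iff)
qed

lemma projectiveI:
  assumes "\<And>e f. epic C e \<Longrightarrow> src C f = P \<Longrightarrow> tgt C f = tgt C e \<Longrightarrow>
    \<exists>g. src C g = P \<and> tgt C g = src C e \<and> e \<cdot> g = f"
  shows "projective C P"
  unfolding projective_def
proof (intro allI ballI impI)
  fix X Y e f assume "e \<in> Hom C X Y" "f \<in> Hom C P Y" "epic C e"
  hence "epic C e" "src C f = P" "tgt C f = tgt C e" "src C e = X" by (simp_all add: in_Hom_iff)
  then obtain g where "src C g = P" "tgt C g = X" "e \<cdot> g = f" using assms by metis
  thus "\<exists>g\<in>Hom C P X. e \<cdot> g = f" by (intro bexI[of _ g]) (simp_all add: in_Hom_iff)
qed

end

locale abelian_pivotal_category = pivotal_tensor_category + abelian_linear_category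
begin

lemma pairing_dual: "exact_pairing C V (V\<^sup>\<star>) (coev V) (ev V)"
  using ev_in_Hom[of V] coev_in_Hom[of V] zigzag[of V] zigzag_dual[of V]
  by unfold_locales (simp_all add: in_Hom_iff)

lemma pairing_dual_tilde: "exact_pairing C (V\<^sup>\<star>) V (coevt V) (evt V)"
  using evt_in_Hom[of V] coevt_in_Hom[of V] zigzag_tilde[of V] zigzag_tilde_dual[of V]
  by unfold_locales (simp_all add: in_Hom_iff)

text \<open>A lifting problem for \<open>Z \<boxtimes> Q\<close> transposes to one for \<open>Q\<close>, because \<open>Z\<^sup>\<star> \<boxtimes> -\<close> preserves epimorphisms.\<close>

lemma projective_tensor:
  assumes "projective C Q"
  shows "projective C (Z \<boxtimes> Q)"
proof (rule projectiveI)
  interpret T: exact_pairing C "Z\<^sup>\<star>" Z "coevt Z" "evt Z" by (rule pairing_dual_tilde)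
  interpret D: exact_pairing C Z "Z\<^sup>\<star>" "coev Z" "ev Z" by (rule pairing_dual)
  fix e f assume e: "epic C e" and f: "src C f = Z \<boxtimes> Q" "tgt C f = tgt C e"
  have "epic C (\<iota> (Z\<^sup>\<star>) \<boxtimes>\<^sub>m e)" by (rule D.tensor_left_epic[OF e])
  then obtain h where h: "src C h = Q" "tgt C h = Z\<^sup>\<star> \<boxtimes> src C e"
      "(\<iota> (Z\<^sup>\<star>) \<boxtimes>\<^sub>m e) \<cdot> h = T.curry_left Q f"
    using f by (elim projective_lift[OF assms, of _ "T.curry_left Q f"]) simp_all
  have "e \<cdot> T.uncurry_left (src C e) h = T.uncurry_left (tgt C e) (T.curry_left Q f)"
    unfolding h(3)[symmetric] using h by (intro T.uncurry_left_whisker[symmetric]) simp_all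
  also have "\<dots> = f" unfolding f(2)[symmetric] by (rule T.uncurry_curry_left[OF f(1)])
  finally show "\<exists>g. src C g = Z \<boxtimes> Q \<and> tgt C g = src C e \<and> e \<cdot> g = f"
    using h by (intro exI[of _ "T.uncurry_left (src C e) h"]) simp
qed

text \<open>If \<open>c\<close> is the cokernel of \<open>i\<close>, then \<open>c \<boxtimes> Q\<close> is an
  epimorphism onto a projective object and splits by some \<open>s\<close>; so its kernel \<open>i \<boxtimes> Q\<close> splits too, the
  retraction being the factorisation of \<open>1 - s (c \<boxtimes> Q)\<close> through \<open>i \<boxtimes> Q\<close>.\<close>

lemma monic_tensor_projective_splits:
  assumes i: "monic C i" and Q: "projective C Q"
  obtains r where "src C r = tgt C i \<boxtimes> Q" "tgt C r = src C i \<boxtimes> Q" "r \<cdot> (i \<boxtimes>\<^sub>m \<iota> Q) = \<iota> (src C i \<boxtimes> Q)"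
proof -
  interpret T: exact_pairing C "Q\<^sup>\<star>" Q "coevt Q" "evt Q" by (rule pairing_dual_tilde)
  interpret D: exact_pairing C Q "Q\<^sup>\<star>" "coev Q" "ev Q" by (rule pairing_dual)
  obtain c where c: "kernel_of C c i" "epic C c" by (rule monic_is_kernel_of_epic[OF i])
  note tc = kernel_ofD[OF c(1)]
  have ci: "(c \<boxtimes>\<^sub>m \<iota> Q) \<cdot> (i \<boxtimes>\<^sub>m \<iota> Q) = \<zero>\<^sub>m (src C i \<boxtimes> Q) (tgt C c \<boxtimes> Q)"
    using tc by (subst whisker_right[symmetric]) simp_all
  have "epic C (c \<boxtimes>\<^sub>m \<iota> Q)" by (rule D.tensor_right_epic[OF c(2)])
  then obtain s where s: "src C s = tgt C c \<boxtimes> Q" "tgt C s = src C c \<boxtimes> Q"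
      "(c \<boxtimes>\<^sub>m \<iota> Q) \<cdot> s = \<iota> (tgt C c \<boxtimes> Q)"
    by (elim projective_lift[OF projective_tensor[OF Q, of "tgt C c"], of _ "\<iota> (tgt C c \<boxtimes> Q)"]) simp_all
  define d where "d = \<iota> (src C c \<boxtimes> Q) \<ominus>\<^sub>m s \<cdot> (c \<boxtimes>\<^sub>m \<iota> Q)"
  have td: "src C d = src C c \<boxtimes> Q" "tgt C d = src C c \<boxtimes> Q" using s unfolding d_def by simp_all
  have "(c \<boxtimes>\<^sub>m \<iota> Q) \<cdot> d = (c \<boxtimes>\<^sub>m \<iota> Q) \<ominus>\<^sub>m ((c \<boxtimes>\<^sub>m \<iota> Q) \<cdot> s) \<cdot> (c \<boxtimes>\<^sub>m \<iota> Q)"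
    unfolding d_def using s by (subst assoc) (simp_all add: comp_diff)
  also have "\<dots> = \<zero>\<^sub>m (src C d) (tgt C c \<boxtimes> Q)"
    using s td diff_eq_zero_iff[of "c \<boxtimes>\<^sub>m \<iota> Q" "c \<boxtimes>\<^sub>m \<iota> Q"] by simp
  finally obtain r where r: "src C r = src C d" "tgt C r = src C i \<boxtimes> Q" "(i \<boxtimes>\<^sub>m \<iota> Q) \<cdot> r = d"
    using T.tensor_right_factor[OF c(1) td(2)] by blast
  have "(i \<boxtimes>\<^sub>m \<iota> Q) \<cdot> (r \<cdot> (i \<boxtimes>\<^sub>m \<iota> Q)) = d \<cdot> (i \<boxtimes>\<^sub>m \<iota> Q)"
    unfolding r(3)[symmetric] using r td tc by (intro assoc[symmetric]) simp_all
  also have "\<dots> = (i \<boxtimes>\<^sub>m \<iota> Q) \<ominus>\<^sub>m (s \<cdot> (c \<boxtimes>\<^sub>m \<iota> Q)) \<cdot> (i \<boxtimes>\<^sub>m \<iota> Q)"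
    unfolding d_def using tc s by (subst diff_comp) simp_all
  also have "(s \<cdot> (c \<boxtimes>\<^sub>m \<iota> Q)) \<cdot> (i \<boxtimes>\<^sub>m \<iota> Q) = \<zero>\<^sub>m (src C i \<boxtimes> Q) (tgt C i \<boxtimes> Q)"
    using s tc ci by (subst assoc) simp_all
  also have "(i \<boxtimes>\<^sub>m \<iota> Q) \<ominus>\<^sub>m \<zero>\<^sub>m (src C i \<boxtimes> Q) (tgt C i \<boxtimes> Q) = (i \<boxtimes>\<^sub>m \<iota> Q)"
    unfolding diff_def using add_zero[of "i \<boxtimes>\<^sub>m \<iota> Q"] by simp
  also have "\<dots> = (i \<boxtimes>\<^sub>m \<iota> Q) \<cdot> \<iota> (src C i \<boxtimes> Q)" by simp
  finally have "r \<cdot> (i \<boxtimes>\<^sub>m \<iota> Q) = \<iota> (src C i \<boxtimes> Q)"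
    by (rule monic_cancel[OF T.tensor_right_monic[OF i], rotated -1]) (use r td tc in simp_all)
  thus thesis using that r td tc by simp
qed

text \<open>By a zig-zag identity \<open>f\<close> factors through \<open>src i \<boxtimes> coevt P\<close>, whose target \<open>src i \<boxtimes> P\<^sup>\<star> \<boxtimes> P\<close> is a
  retract of \<open>tgt i \<boxtimes> P\<^sup>\<star> \<boxtimes> P\<close> as \<open>P\<^sup>\<star> \<boxtimes> P\<close> is projective.\<close>

lemma projective_imp_injective:
  assumes P: "projective C P" and i: "monic C i" and f: "src C f = src C i" "tgt C f = P"
  obtains g where "src C g = tgt C i" "tgt C g = P" "g \<cdot> i = f"
proof -
  interpret T: exact_pairing C "P\<^sup>\<star>" P "coevt P" "evt P" by (rule pairing_dual_tilde)
  let ?W = "P\<^sup>\<star> \<boxtimes> P"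
  obtain r where r: "src C r = tgt C i \<boxtimes> ?W" "tgt C r = src C i \<boxtimes> ?W"
      "r \<cdot> (i \<boxtimes>\<^sub>m \<iota> ?W) = \<iota> (src C i \<boxtimes> ?W)"
    by (rule monic_tensor_projective_splits[OF i projective_tensor[OF P]])
  define a where "a = (evt P \<boxtimes>\<^sub>m \<iota> P) \<cdot> (f \<boxtimes>\<^sub>m \<iota> ?W)"
  have ta: "src C a = src C i \<boxtimes> ?W" "tgt C a = P" unfolding a_def using f by simp_all
  have "(a \<cdot> (r \<cdot> (\<iota> (tgt C i) \<boxtimes>\<^sub>m coevt P))) \<cdot> i = a \<cdot> (r \<cdot> ((\<iota> (tgt C i) \<boxtimes>\<^sub>m coevt P) \<cdot> i))"
    using ta r by (simp add: assoc)
  also have "(\<iota> (tgt C i) \<boxtimes>\<^sub>m coevt P) \<cdot> i = (i \<boxtimes>\<^sub>m \<iota> ?W) \<cdot> (\<iota> (src C i) \<boxtimes>\<^sub>m coevt P)"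
    using slide[of i "src C i" "tgt C i" "coevt P" \<bbbone> ?W] by simp
  also have "r \<cdot> ((i \<boxtimes>\<^sub>m \<iota> ?W) \<cdot> (\<iota> (src C i) \<boxtimes>\<^sub>m coevt P)) =
      (r \<cdot> (i \<boxtimes>\<^sub>m \<iota> ?W)) \<cdot> (\<iota> (src C i) \<boxtimes>\<^sub>m coevt P)"
    using r(1) by (intro assoc[symmetric]) simp_all
  also have "\<dots> = \<iota> (src C i) \<boxtimes>\<^sub>m coevt P" unfolding r(3) by simp
  also have "a \<cdot> (\<iota> (src C i) \<boxtimes>\<^sub>m coevt P) =
      (evt P \<boxtimes>\<^sub>m \<iota> P) \<cdot> ((f \<boxtimes>\<^sub>m \<iota> ?W) \<cdot> (\<iota> (src C i) \<boxtimes>\<^sub>m coevt P))"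
    unfolding a_def using f by (intro assoc) simp_all
  also have "(f \<boxtimes>\<^sub>m \<iota> ?W) \<cdot> (\<iota> (src C i) \<boxtimes>\<^sub>m coevt P) = (\<iota> P \<boxtimes>\<^sub>m coevt P) \<cdot> f"
    using slide[of f "src C i" P "coevt P" \<bbbone> ?W] f by simp
  also have "(evt P \<boxtimes>\<^sub>m \<iota> P) \<cdot> ((\<iota> P \<boxtimes>\<^sub>m coevt P) \<cdot> f) = ((evt P \<boxtimes>\<^sub>m \<iota> P) \<cdot> (\<iota> P \<boxtimes>\<^sub>m coevt P)) \<cdot> f"
    using f by (intro assoc[symmetric]) simp_all
  also have "\<dots> = f" using f by (simp add: zigzag_tilde)
  finally show thesis using that[of "a \<cdot> (r \<cdot> (\<iota> (tgt C i) \<boxtimes>\<^sub>m coevt P))"] ta r by simp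
qed


section \<open>Partial traces\<close>

lemma src_partial_trace [simp]: "src C a = X \<boxtimes> Q \<Longrightarrow> tgt C a = Y \<boxtimes> Q \<Longrightarrow> src C (right_partial_trace C X Y Q a) = X"
  and tgt_partial_trace [simp]: "src C a = X \<boxtimes> Q \<Longrightarrow> tgt C a = Y \<boxtimes> Q \<Longrightarrow> tgt C (right_partial_trace C X Y Q a) = Y"
proof -
  interpret T: exact_pairing C "Q\<^sup>\<star>" Q "coevt Q" "evt Q" by (rule pairing_dual_tilde)
  interpret D: exact_pairing C Q "Q\<^sup>\<star>" "coev Q" "ev Q" by (rule pairing_dual)
  assume "src C a = X \<boxtimes> Q" "tgt C a = Y \<boxtimes> Q"
  thus "src C (right_partial_trace C X Y Q a) = X" "tgt C (right_partial_trace C X Y Q a) = Y"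
    unfolding right_partial_trace_def by simp_all
qed

text \<open>The partial trace of a composite through any object \<open>V\<close> is a composite of two transposes through
  \<open>V \<boxtimes> Q\<^sup>\<star>\<close>. This is what makes the trace pairing accessible: one transpose of a nonzero morphism at
  \<open>\<alpha>\<close> or \<open>\<beta>\<close> is monic or epic, and the other one may be prescribed.\<close>

lemma partial_trace_comp:
  assumes f: "src C f = X \<boxtimes> Q" and g: "src C g = tgt C f" "tgt C g = Y \<boxtimes> Q"
  shows "right_partial_trace C X Y Q (g \<cdot> f) =
    exact_pairing.uncurry_right C (Q\<^sup>\<star>) (evt Q) Y g \<cdot> exact_pairing.curry_right C (Q\<^sup>\<star>) (coev Q) X f"
proof -
  interpret T: exact_pairing C "Q\<^sup>\<star>" Q "coevt Q" "evt Q" by (rule pairing_dual_tilde)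
  interpret D: exact_pairing C Q "Q\<^sup>\<star>" "coev Q" "ev Q" by (rule pairing_dual)
  have "right_partial_trace C X Y Q (g \<cdot> f) =
      ((\<iota> Y \<boxtimes>\<^sub>m evt Q) \<cdot> ((g \<boxtimes>\<^sub>m \<iota> (Q\<^sup>\<star>)) \<cdot> (f \<boxtimes>\<^sub>m \<iota> (Q\<^sup>\<star>)))) \<cdot> (\<iota> X \<boxtimes>\<^sub>m coev Q)"
    unfolding right_partial_trace_def using g by (subst whisker_right) simp_all
  also have "\<dots> = T.uncurry_right Y g \<cdot> D.curry_right X f"
    unfolding T.uncurry_right_def D.curry_right_def using f g by (simp add: assoc)
  finally show ?thesis .
qed

lemma partial_trace_post:
  assumes a: "src C a = X \<boxtimes> Q" "tgt C a = Y \<boxtimes> Q" and b: "src C b = Y"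
  shows "right_partial_trace C X (tgt C b) Q ((b \<boxtimes>\<^sub>m \<iota> Q) \<cdot> a) = b \<cdot> right_partial_trace C X Y Q a"
proof -
  interpret T: exact_pairing C "Q\<^sup>\<star>" Q "coevt Q" "evt Q" by (rule pairing_dual_tilde)
  interpret D: exact_pairing C Q "Q\<^sup>\<star>" "coev Q" "ev Q" by (rule pairing_dual)
  show ?thesis
    using T.uncurry_right_whisker[of a Y b] a b
    by (simp add: right_partial_trace_def T.uncurry_right_def assoc)
qed

lemma partial_trace_pre:
  assumes a: "src C a = X \<boxtimes> Q" "tgt C a = Y \<boxtimes> Q" and u: "tgt C u = X"
  shows "right_partial_trace C (src C u) Y Q (a \<cdot> (u \<boxtimes>\<^sub>m \<iota> Q)) = right_partial_trace C X Y Q a \<cdot> u"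
proof -
  interpret T: exact_pairing C "Q\<^sup>\<star>" Q "coevt Q" "evt Q" by (rule pairing_dual_tilde)
  interpret D: exact_pairing C Q "Q\<^sup>\<star>" "coev Q" "ev Q" by (rule pairing_dual)
  show ?thesis
    using D.curry_right_whisker[of a X u] a u
    by (simp add: right_partial_trace_def D.curry_right_def assoc)
qed

lemma partial_trace_add:
  assumes "src C a = X \<boxtimes> Q" "tgt C a = Y \<boxtimes> Q" "src C b = X \<boxtimes> Q" "tgt C b = Y \<boxtimes> Q"
  shows "right_partial_trace C X Y Q (a \<oplus>\<^sub>m b) =
    right_partial_trace C X Y Q a \<oplus>\<^sub>m right_partial_trace C X Y Q b"
proof -
  interpret T: exact_pairing C "Q\<^sup>\<star>" Q "coevt Q" "evt Q" by (rule pairing_dual_tilde)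
  interpret D: exact_pairing C Q "Q\<^sup>\<star>" "coev Q" "ev Q" by (rule pairing_dual)
  have "(a \<oplus>\<^sub>m b) \<boxtimes>\<^sub>m \<iota> (Q\<^sup>\<star>) = a \<boxtimes>\<^sub>m \<iota> (Q\<^sup>\<star>) \<oplus>\<^sub>m b \<boxtimes>\<^sub>m \<iota> (Q\<^sup>\<star>)"
    using assms by (intro tensor_add_left) (auto simp: in_Hom_iff)
  thus ?thesis unfolding right_partial_trace_def using assms by (simp add: comp_add add_comp)
qed

lemma partial_trace_scale:
  assumes "src C a = X \<boxtimes> Q" "tgt C a = Y \<boxtimes> Q"
  shows "right_partial_trace C X Y Q (c \<odot>\<^sub>m a) = c \<odot>\<^sub>m right_partial_trace C X Y Q a"
proof -
  interpret T: exact_pairing C "Q\<^sup>\<star>" Q "coevt Q" "evt Q" by (rule pairing_dual_tilde)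
  interpret D: exact_pairing C Q "Q\<^sup>\<star>" "coev Q" "ev Q" by (rule pairing_dual)
  show ?thesis unfolding right_partial_trace_def using assms by simp
qed

end


section \<open>The projective cover of a simple object\<close>

context linear_category
begin

lemma End_ring: "ring (Hom_module C X X)"
proof (rule ringI)
  interpret M: module scalars "Hom_module C X X" by (rule Hom_module)
  show "abelian_group (Hom_module C X X)" by (rule M.abelian_group_axioms)
  show "Group.monoid (Hom_module C X X)"
    by (rule monoidI) (auto simp: in_Hom_iff assoc)
qed (auto simp: in_Hom_iff add_comp comp_add)

lemma scale_eq_zeroD:
  fixes c :: 'k
  assumes "c \<odot>\<^sub>m f = \<zero>\<^sub>m (src C f) (tgt C f)" "d * c = 1"
  shows "f = \<zero>\<^sub>m (src C f) (tgt C f)"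
  using scale_scale[of d c f] assms by simp

end

locale simple_projective_cover = abelian_pivotal_category C
  for C :: "('o, 'm, 'k::alg_closed_field) tensor_data" (structure) +
  fixes S P \<alpha> \<beta> :: 'o and p \<eta> \<epsilon> :: 'm
  assumes finite_End: "finite_length_module scalars (Hom_module C P P)"
    and simple_S: "simple_object C S" and cover: "projective_cover C S P p"
    and simple_\<beta>: "simple_object C \<beta>" and \<epsilon>: "\<epsilon> \<in> Hom C P \<beta>" "epic C \<epsilon>"
    and simple_\<alpha>: "simple_object C \<alpha>" and \<eta>: "\<eta> \<in> Hom C \<alpha> P" "monic C \<eta>"
begin

lemma types [simp]: "src C p = P" "tgt C p = S" "src C \<epsilon> = P" "tgt C \<epsilon> = \<beta>" "src C \<eta> = \<alpha>" "tgt C \<eta> = P"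
  using cover \<epsilon>(1) \<eta>(1) by (simp_all add: projective_cover_def in_Hom_iff)

lemma projective_P: "projective C P" and epic_p: "epic C p"
  using cover by (simp_all add: projective_cover_def)

lemma epic_if_cover_epic: "tgt C e = P \<Longrightarrow> epic C (p \<cdot> e) \<Longrightarrow> epic C e"
  using cover unfolding projective_cover_def by (metis in_Hom)

lemma nonzero [simp]: "p \<noteq> \<zero>\<^sub>m P S" "\<epsilon> \<noteq> \<zero>\<^sub>m P \<beta>" "\<eta> \<noteq> \<zero>\<^sub>m \<alpha> P"
  using epic_to_simple_nonzero[OF epic_p] epic_to_simple_nonzero[OF \<epsilon>(2)]
    monic_from_simple_nonzero[OF \<eta>(2)] simple_S simple_\<beta> simple_\<alpha> by simp_all

abbreviation "E \<equiv> Hom_module C P P"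

text \<open>The candidate for the radical of the endomorphism ring of \<open>P\<close>.\<close>

definition "J = {e \<in> Hom C P P. p \<cdot> e = \<zero>\<^sub>m P S}"

lemma in_J_iff: "e \<in> J \<longleftrightarrow> src C e = P \<and> tgt C e = P \<and> p \<cdot> e = \<zero>\<^sub>m P S"
  by (auto simp: J_def in_Hom_iff)

text \<open>If \<open>p r \<noteq> 0\<close>, then \<open>p r\<close> is epic as \<open>S\<close> is simple, so \<open>r\<close> is epic as \<open>p\<close> is essential, so \<open>r\<close> splits
  as \<open>P\<close> is projective.\<close>

lemma local_End: "local_ring E J"
proof -
  interpret R: ring E by (rule End_ring)
  interpret M: module scalars E by (rule Hom_module)
  have "submodule J scalars E"
  proof (rule M.submoduleI)
    show "J \<subseteq> carrier E" by (auto simp: J_def)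
    show "\<zero>\<^bsub>E\<^esub> \<in> J" by (simp add: in_J_iff)
    fix e assume e: "e \<in> J"
    have "\<ominus>\<^bsub>E\<^esub> e = (-1) \<odot>\<^sub>m e" using M.smult_l_minus[of 1 e] e by (simp add: in_J_iff in_Hom_iff)
    thus "\<ominus>\<^bsub>E\<^esub> e \<in> J" using e by (simp add: in_J_iff)
  next
    fix a b assume "a \<in> J" "b \<in> J"
    thus "a \<oplus>\<^bsub>E\<^esub> b \<in> J" using add_zero[of "\<zero>\<^sub>m P S"] by (simp add: in_J_iff comp_add)
  qed (simp add: in_J_iff)
  hence sub: "subgroup J (add_monoid E)" by (rule submodule.axioms)
  show ?thesis
  proof (rule local_ring.intro[OF R.ring_axioms local_ring_axioms.intro])
    show "subgroup J (add_monoid E)" by (rule sub)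
  next
    fix x r assume "x \<in> J" "r \<in> carrier E"
    thus "x \<otimes>\<^bsub>E\<^esub> r \<in> J" by (simp add: in_J_iff in_Hom_iff assoc[symmetric])
  next
    show "\<one>\<^bsub>E\<^esub> \<notin> J" by (simp add: in_J_iff)
  next
    fix r assume r: "r \<in> carrier E" "r \<notin> J"
    hence tr: "src C r = P" "tgt C r = P" by (simp_all add: in_Hom_iff)
    have "p \<cdot> r \<noteq> \<zero>\<^sub>m P S" using r tr by (simp add: in_J_iff)
    hence "epic C (p \<cdot> r)" using tr simple_S by (intro epic_to_simple) simp_all
    hence epic_r: "epic C r" using tr by (simp add: epic_if_cover_epic)
    obtain s where "src C s = P" "tgt C s = P" "r \<cdot> s = \<iota> P"
      using projective_lift[OF projective_P epic_r, of "\<iota> P"] tr by (metis src_id tgt_id)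
    thus "\<exists>s\<in>carrier E. r \<otimes>\<^bsub>E\<^esub> s = \<one>\<^bsub>E\<^esub>" by (intro bexI[of _ s]) (simp_all add: in_Hom_iff)
  qed
qed

lemma algebra_End: "finite_length_local_algebra E J"
proof -
  interpret L: local_ring E J by (rule local_End)
  interpret M: module scalars E by (rule Hom_module)
  show ?thesis
    by unfold_locales (simp_all add: finite_End in_Hom_iff)
qed

lemma one_diff_inverse:
  assumes y: "y \<in> J"
  obtains t where "src C t = P" "tgt C t = P" "(\<iota> P \<ominus>\<^sub>m y) \<cdot> t = \<iota> P" "t \<cdot> (\<iota> P \<ominus>\<^sub>m y) = \<iota> P"
proof -
  interpret L: local_ring E J by (rule local_End)
  have ty: "src C y = P" "tgt C y = P" "p \<cdot> y = \<zero>\<^sub>m P S" using y by (simp_all add: in_J_iff)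
  have "p \<cdot> (\<iota> P \<ominus>\<^sub>m y) = p"
    using ty add_zero[of p] by (simp add: comp_diff) (simp add: diff_def)
  hence "\<iota> P \<ominus>\<^sub>m y \<notin> J" by (simp add: in_J_iff)
  thus thesis using L.two_sided_inverse[of "\<iota> P \<ominus>\<^sub>m y"] ty that by (auto simp: in_Hom_iff)
qed

text \<open>If \<open>\<epsilon> j\<close> were nonzero, it would be an epimorphism onto \<open>\<beta>\<close>, and lifting \<open>\<epsilon>\<close> along it would give
  \<open>\<epsilon> = \<epsilon> j x\<close>, although \<open>1 - j x\<close> is invertible.\<close>

lemma \<epsilon>_comp_J:
  assumes j: "j \<in> J"
  shows "\<epsilon> \<cdot> j = \<zero>\<^sub>m P \<beta>"
proof (rule ccontr)
  interpret L: local_ring E J by (rule local_End)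
  have tj: "src C j = P" "tgt C j = P" using j by (simp_all add: in_J_iff)
  assume "\<epsilon> \<cdot> j \<noteq> \<zero>\<^sub>m P \<beta>"
  hence "epic C (\<epsilon> \<cdot> j)" using tj simple_\<beta> by (intro epic_to_simple) simp_all
  then obtain x where x: "src C x = P" "tgt C x = P" "(\<epsilon> \<cdot> j) \<cdot> x = \<epsilon>"
    using tj by (elim projective_lift[OF projective_P, of _ \<epsilon>]) simp_all
  have "j \<cdot> x \<in> J" using L.right_closed[OF j, of x] x by (simp add: in_Hom_iff)
  then obtain t where t: "src C t = P" "tgt C t = P" "(\<iota> P \<ominus>\<^sub>m j \<cdot> x) \<cdot> t = \<iota> P"
    by (rule one_diff_inverse)
  have "\<epsilon> \<cdot> (\<iota> P \<ominus>\<^sub>m j \<cdot> x) = \<epsilon> \<ominus>\<^sub>m (\<epsilon> \<cdot> j) \<cdot> x" using tj x(1,2) by (simp add: comp_diff assoc)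
  also have "\<dots> = \<zero>\<^sub>m P \<beta>" unfolding x(3) using diff_eq_zero_iff[of \<epsilon> \<epsilon>] by simp
  finally have "(\<epsilon> \<cdot> (\<iota> P \<ominus>\<^sub>m j \<cdot> x)) \<cdot> t = \<zero>\<^sub>m P \<beta>" using t by simp
  hence "\<epsilon> \<cdot> ((\<iota> P \<ominus>\<^sub>m j \<cdot> x) \<cdot> t) = \<zero>\<^sub>m P \<beta>" using t(1,2) tj x(1,2) by (simp add: assoc)
  thus False unfolding t(3) by simp
qed

text \<open>Dual to the preceding lemma, with the injectivity of \<open>P\<close> in place of its projectivity.\<close>

lemma J_comp_\<eta>:
  assumes j: "j \<in> J"
  shows "j \<cdot> \<eta> = \<zero>\<^sub>m \<alpha> P"
proof (rule ccontr)
  interpret L: local_ring E J by (rule local_End)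
  have tj: "src C j = P" "tgt C j = P" using j by (simp_all add: in_J_iff)
  assume "j \<cdot> \<eta> \<noteq> \<zero>\<^sub>m \<alpha> P"
  hence "monic C (j \<cdot> \<eta>)" using tj simple_\<alpha> by (intro monic_from_simple) simp_all
  then obtain x where x: "src C x = P" "tgt C x = P" "x \<cdot> (j \<cdot> \<eta>) = \<eta>"
    using tj by (elim projective_imp_injective[OF projective_P, of _ \<eta>]) simp_all
  have "x \<cdot> j \<in> J" using L.left_closed[OF j, of x] x by (simp add: in_Hom_iff)
  then obtain t where t: "src C t = P" "tgt C t = P" "t \<cdot> (\<iota> P \<ominus>\<^sub>m x \<cdot> j) = \<iota> P"
    by (rule one_diff_inverse)
  have "(\<iota> P \<ominus>\<^sub>m x \<cdot> j) \<cdot> \<eta> = \<eta> \<ominus>\<^sub>m x \<cdot> (j \<cdot> \<eta>)" using tj x(1,2) by (simp add: diff_comp assoc)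
  also have "\<dots> = \<zero>\<^sub>m \<alpha> P" unfolding x(3) using diff_eq_zero_iff[of \<eta> \<eta>] by simp
  finally have "t \<cdot> ((\<iota> P \<ominus>\<^sub>m x \<cdot> j) \<cdot> \<eta>) = \<zero>\<^sub>m \<alpha> P" using t by simp
  hence "(t \<cdot> (\<iota> P \<ominus>\<^sub>m x \<cdot> j)) \<cdot> \<eta> = \<zero>\<^sub>m \<alpha> P" using t(1,2) tj x(1,2) by (simp add: assoc)
  thus False unfolding t(3) by simp
qed

text \<open>The key fact on \<open>P\<close>: an endomorphism is a scalar plus an element of \<open>J\<close>, which \<open>\<epsilon>\<close> and \<open>\<eta>\<close> do not
  see. The same scalar occurs at the top and at the socle.\<close>

lemma End_acts_by_scalar:
  assumes e: "src C e = P" "tgt C e = P"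
  obtains c where "\<epsilon> \<cdot> e = c \<odot>\<^sub>m \<epsilon>" "e \<cdot> \<eta> = c \<odot>\<^sub>m \<eta>"
proof -
  interpret A: finite_length_local_algebra E J by (rule algebra_End)
  obtain c where c: "e \<ominus>\<^bsub>E\<^esub> c \<odot>\<^sub>m \<iota> P \<in> J"
    using A.exists_scalar_mod_J[of e] e by (auto simp: in_Hom_iff)
  have "e \<ominus>\<^bsub>E\<^esub> c \<odot>\<^sub>m \<iota> P = e \<ominus>\<^sub>m c \<odot>\<^sub>m \<iota> P"
    using A.uminus_smult[of "c \<odot>\<^sub>m \<iota> P" 1] A.minus_eq[of e "c \<odot>\<^sub>m \<iota> P"]
    by (simp add: diff_def in_Hom_iff)
  hence j: "e \<ominus>\<^sub>m c \<odot>\<^sub>m \<iota> P \<in> J" using c by simp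
  have "\<epsilon> \<cdot> e \<ominus>\<^sub>m c \<odot>\<^sub>m \<epsilon> = \<zero>\<^sub>m P \<beta>" using \<epsilon>_comp_J[OF j] e by (simp add: comp_diff)
  hence "\<epsilon> \<cdot> e = c \<odot>\<^sub>m \<epsilon>" using diff_eq_zero_iff[of "\<epsilon> \<cdot> e" "c \<odot>\<^sub>m \<epsilon>"] e by simp
  moreover have "e \<cdot> \<eta> \<ominus>\<^sub>m c \<odot>\<^sub>m \<eta> = \<zero>\<^sub>m \<alpha> P" using J_comp_\<eta>[OF j] e by (simp add: diff_comp)
  hence "e \<cdot> \<eta> = c \<odot>\<^sub>m \<eta>" using diff_eq_zero_iff[of "e \<cdot> \<eta>" "c \<odot>\<^sub>m \<eta>"] e by simp
  ultimately show thesis by (rule that)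
qed

lemma scale_cancel:
  fixes c d :: 'k
  assumes "c \<odot>\<^sub>m f = d \<odot>\<^sub>m f" "f \<noteq> \<zero>\<^sub>m (src C f) (tgt C f)"
  shows "c = d"
proof (rule ccontr)
  assume "c \<noteq> d"
  have "(c - d) \<odot>\<^sub>m f = c \<odot>\<^sub>m f \<ominus>\<^sub>m d \<odot>\<^sub>m f"
    using scale_add_left[of c "- d" f] by (simp add: diff_def scale_scale)
  also have "\<dots> = \<zero>\<^sub>m (src C f) (tgt C f)" using diff_eq_zero_iff[of "c \<odot>\<^sub>m f" "d \<odot>\<^sub>m f"] assms(1) by simp
  finally have "f = \<zero>\<^sub>m (src C f) (tgt C f)"
    by (rule scale_eq_zeroD[of _ _ "inverse (c - d)"]) (use \<open>c \<noteq> d\<close> in simp)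
  thus False using assms(2) by simp
qed

lemma Hom_\<alpha>_P:
  assumes "g \<in> Hom C \<alpha> P"
  shows "\<exists>!c. g = c \<odot>\<^sub>m \<eta>"
proof -
  have "src C g = \<alpha>" "tgt C g = P" using assms by (simp_all add: in_Hom_iff)
  then obtain e where e: "src C e = P" "tgt C e = P" "e \<cdot> \<eta> = g"
    using projective_imp_injective[OF projective_P \<eta>(2), of g] types by metis
  then obtain c where "g = c \<odot>\<^sub>m \<eta>" using End_acts_by_scalar by metis
  thus ?thesis using scale_cancel[of _ \<eta>] by auto
qed

lemma Hom_P_\<beta>:
  assumes "h \<in> Hom C P \<beta>"
  shows "\<exists>!c. h = c \<odot>\<^sub>m \<epsilon>"
proof -
  have "src C h = P" "tgt C h = \<beta>" using assms by (simp_all add: in_Hom_iff)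
  then obtain e where e: "src C e = P" "tgt C e = P" "\<epsilon> \<cdot> e = h"
    using projective_lift[OF projective_P \<epsilon>(2), of h] types by metis
  then obtain c where "h = c \<odot>\<^sub>m \<epsilon>" using End_acts_by_scalar by metis
  thus ?thesis using scale_cancel[of _ \<epsilon>] by auto
qed

lemma is_trace_tuple: "trace_tuple C P \<alpha> \<beta> \<eta> \<epsilon>"
proof -
  interpret A: finite_length_local_algebra E J by (rule algebra_End)
  show ?thesis unfolding trace_tuple_def Let_def A.jacobson_radical_eq
    using A.nilpotent A.scalars_iso_quotient \<epsilon>(1) \<eta>(1) Hom_\<alpha>_P Hom_P_\<beta> by simp
qed


section \<open>The trace pairing\<close>

text \<open>The monomorphism \<open>\<eta> \<boxtimes> Q\<close> and the epimorphism \<open>\<epsilon> \<boxtimes> Q\<close> both split.\<close>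

lemma exists_inverses:
  assumes "projective C Q"
  obtains \<sigma> \<tau> where "left_inverse_at C P \<alpha> \<eta> Q \<sigma>" "right_inverse_at C P \<beta> \<epsilon> Q \<tau>"
proof -
  interpret D: exact_pairing C Q "Q\<^sup>\<star>" "coev Q" "ev Q" by (rule pairing_dual)
  obtain \<sigma> where \<sigma>: "src C \<sigma> = P \<boxtimes> Q" "tgt C \<sigma> = \<alpha> \<boxtimes> Q" "\<sigma> \<cdot> (\<eta> \<boxtimes>\<^sub>m \<iota> Q) = \<iota> (\<alpha> \<boxtimes> Q)"
    using monic_tensor_projective_splits[OF \<eta>(2) assms] types by metis
  have "epic C (\<epsilon> \<boxtimes>\<^sub>m \<iota> Q)" by (rule D.tensor_right_epic[OF \<epsilon>(2)])
  from projective_lift[OF projective_tensor[OF assms, of \<beta>] this, of "\<iota> (\<beta> \<boxtimes> Q)"]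
  obtain \<tau> where \<tau>: "src C \<tau> = \<beta> \<boxtimes> Q" "tgt C \<tau> = P \<boxtimes> Q" "(\<epsilon> \<boxtimes>\<^sub>m \<iota> Q) \<cdot> \<tau> = \<iota> (\<beta> \<boxtimes> Q)"
    by auto
  show thesis using that[of \<sigma> \<tau>] \<sigma> \<tau>
    by (simp add: left_inverse_at_def right_inverse_at_def in_Hom_iff)
qed

lemma projective_in_trace_ideal: "{Q. projective C Q} \<subseteq> trace_ideal C P \<alpha> \<beta> \<eta> \<epsilon>"
proof
  fix Q assume "Q \<in> {Q. projective C Q}"
  then obtain \<sigma> \<tau> where "left_inverse_at C P \<alpha> \<eta> Q \<sigma>" "right_inverse_at C P \<beta> \<epsilon> Q \<tau>"
    using exists_inverses by blast
  thus "Q \<in> trace_ideal C P \<alpha> \<beta> \<eta> \<epsilon>" unfolding trace_ideal_def by blast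
qed

lemma coefficient_scale: "f \<noteq> \<zero>\<^sub>m (src C f) (tgt C f) \<Longrightarrow> coefficient C f (c \<odot>\<^sub>m f) = c"
  unfolding coefficient_def using scale_cancel[of _ f] by (intro the_equality) auto

text \<open>Both partial traces are obtained from the endomorphism \<open>tr (\<tau> f \<sigma>)\<close> of \<open>P\<close>, by composition with \<open>\<eta>\<close>
  and with \<open>\<epsilon>\<close> respectively, and so both see its scalar.\<close>

lemma trace_scalars_agree:
  assumes \<sigma>: "left_inverse_at C P \<alpha> \<eta> Q \<sigma>" and \<tau>: "right_inverse_at C P \<beta> \<epsilon> Q \<tau>"
    and f: "src C f = \<alpha> \<boxtimes> Q" "tgt C f = \<beta> \<boxtimes> Q"
  obtains c where "right_partial_trace C \<alpha> P Q (\<tau> \<cdot> f) = c \<odot>\<^sub>m \<eta>"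
    "right_partial_trace C P \<beta> Q (f \<cdot> \<sigma>) = c \<odot>\<^sub>m \<epsilon>"
proof -
  have t\<sigma>: "src C \<sigma> = P \<boxtimes> Q" "tgt C \<sigma> = \<alpha> \<boxtimes> Q" "\<sigma> \<cdot> (\<eta> \<boxtimes>\<^sub>m \<iota> Q) = \<iota> (\<alpha> \<boxtimes> Q)"
    and t\<tau>: "src C \<tau> = \<beta> \<boxtimes> Q" "tgt C \<tau> = P \<boxtimes> Q" "(\<epsilon> \<boxtimes>\<^sub>m \<iota> Q) \<cdot> \<tau> = \<iota> (\<beta> \<boxtimes> Q)"
    using \<sigma> \<tau> by (simp_all add: left_inverse_at_def right_inverse_at_def in_Hom_iff)
  let ?e = "right_partial_trace C P P Q (\<tau> \<cdot> f \<cdot> \<sigma>)"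
  obtain c where c: "\<epsilon> \<cdot> ?e = c \<odot>\<^sub>m \<epsilon>" "?e \<cdot> \<eta> = c \<odot>\<^sub>m \<eta>"
    using End_acts_by_scalar[of ?e] t\<sigma> t\<tau> f by auto
  have "(\<tau> \<cdot> f \<cdot> \<sigma>) \<cdot> (\<eta> \<boxtimes>\<^sub>m \<iota> Q) = \<tau> \<cdot> f" using t\<sigma> t\<tau> f by (simp add: assoc)
  moreover have "(\<epsilon> \<boxtimes>\<^sub>m \<iota> Q) \<cdot> (\<tau> \<cdot> f \<cdot> \<sigma>) = f \<cdot> \<sigma>" using t\<sigma> t\<tau> f by (simp add: assoc[symmetric])
  ultimately show thesis
    using that[of c] c partial_trace_pre[of "\<tau> \<cdot> f \<cdot> \<sigma>" P Q P \<eta>]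
      partial_trace_post[of "\<tau> \<cdot> f \<cdot> \<sigma>" P Q P \<epsilon>] t\<sigma> t\<tau> f by simp
qed

text \<open>The trace computed with \<open>\<tau>\<close> agrees with the one computed with any \<open>\<sigma>\<close>, and vice versa; hence neither
  depends on the choice.\<close>

lemma associated_trace_eq:
  assumes \<sigma>: "left_inverse_at C P \<alpha> \<eta> Q \<sigma>" and \<tau>: "right_inverse_at C P \<beta> \<epsilon> Q \<tau>"
    and f: "src C f = \<alpha> \<boxtimes> Q" "tgt C f = \<beta> \<boxtimes> Q"
  shows "right_partial_trace C \<alpha> P Q (\<tau> \<cdot> f) = associated_trace C P \<alpha> \<beta> \<eta> \<epsilon> Q f \<odot>\<^sub>m \<eta>"
    and "right_partial_trace C P \<beta> Q (f \<cdot> \<sigma>) = associated_trace C P \<alpha> \<beta> \<eta> \<epsilon> Q f \<odot>\<^sub>m \<epsilon>"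
proof -
  let ?t = "\<lambda>\<tau>. coefficient C \<eta> (right_partial_trace C \<alpha> P Q (\<tau> \<cdot> f))"
  let ?s = "\<lambda>\<sigma>. coefficient C \<epsilon> (right_partial_trace C P \<beta> Q (f \<cdot> \<sigma>))"
  have agree: "?t \<tau>' = ?s \<sigma>'"
    if "left_inverse_at C P \<alpha> \<eta> Q \<sigma>'" "right_inverse_at C P \<beta> \<epsilon> Q \<tau>'" for \<sigma>' \<tau>'
    using trace_scalars_agree[OF that f] coefficient_scale[of \<eta>] coefficient_scale[of \<epsilon>] types nonzero
    by metis
  obtain c where c: "right_partial_trace C \<alpha> P Q (\<tau> \<cdot> f) = c \<odot>\<^sub>m \<eta>"
    "right_partial_trace C P \<beta> Q (f \<cdot> \<sigma>) = c \<odot>\<^sub>m \<epsilon>"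
    by (rule trace_scalars_agree[OF \<sigma> \<tau> f])
  have "?t \<tau> = c" using c coefficient_scale[of \<eta>] by simp
  have "associated_trace C P \<alpha> \<beta> \<eta> \<epsilon> Q f = c"
    unfolding associated_trace_def
  proof (rule the_equality)
    show "\<forall>\<sigma>' \<tau>'. left_inverse_at C P \<alpha> \<eta> Q \<sigma>' \<and> right_inverse_at C P \<beta> \<epsilon> Q \<tau>' \<longrightarrow>
        c = ?t \<tau>' \<and> c = ?s \<sigma>'"
    proof (intro allI impI, elim conjE)
      fix \<sigma>' \<tau>' assume l: "left_inverse_at C P \<alpha> \<eta> Q \<sigma>'" and r: "right_inverse_at C P \<beta> \<epsilon> Q \<tau>'"
      show "c = ?t \<tau>' \<and> c = ?s \<sigma>'"
        using agree[OF l \<tau>] agree[OF \<sigma> \<tau>] agree[OF \<sigma> r] \<open>?t \<tau> = c\<close> by simp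
    qed
  next
    fix t assume "\<forall>\<sigma>' \<tau>'. left_inverse_at C P \<alpha> \<eta> Q \<sigma>' \<and> right_inverse_at C P \<beta> \<epsilon> Q \<tau>' \<longrightarrow>
        t = ?t \<tau>' \<and> t = ?s \<sigma>'"
    thus "t = c" using \<sigma> \<tau> \<open>?t \<tau> = c\<close> by blast
  qed
  thus "right_partial_trace C \<alpha> P Q (\<tau> \<cdot> f) = associated_trace C P \<alpha> \<beta> \<eta> \<epsilon> Q f \<odot>\<^sub>m \<eta>"
    "right_partial_trace C P \<beta> Q (f \<cdot> \<sigma>) = associated_trace C P \<alpha> \<beta> \<eta> \<epsilon> Q f \<odot>\<^sub>m \<epsilon>"
    using c by simp_all
qed

lemma associated_trace_linear:
  assumes Q: "projective C Q"
  shows "linear_form (Hom_module C (\<alpha> \<boxtimes> Q) (\<beta> \<boxtimes> Q)) (associated_trace C P \<alpha> \<beta> \<eta> \<epsilon> Q)"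
proof -
  obtain \<sigma> \<tau> where \<sigma>: "left_inverse_at C P \<alpha> \<eta> Q \<sigma>" and \<tau>: "right_inverse_at C P \<beta> \<epsilon> Q \<tau>"
    by (rule exists_inverses[OF Q])
  let ?t = "associated_trace C P \<alpha> \<beta> \<eta> \<epsilon> Q"
  note eq = associated_trace_eq(1)[OF \<sigma> \<tau>]
  have t\<tau>: "src C \<tau> = \<beta> \<boxtimes> Q" "tgt C \<tau> = P \<boxtimes> Q"
    using \<tau> by (simp_all add: right_inverse_at_def in_Hom_iff)
  have "?t (f \<oplus>\<^sub>m g) = ?t f + ?t g"
    if f: "src C f = \<alpha> \<boxtimes> Q" "tgt C f = \<beta> \<boxtimes> Q" and g: "src C g = \<alpha> \<boxtimes> Q" "tgt C g = \<beta> \<boxtimes> Q" for f g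
  proof (rule scale_cancel[of _ \<eta>])
    have "?t (f \<oplus>\<^sub>m g) \<odot>\<^sub>m \<eta> = right_partial_trace C \<alpha> P Q (\<tau> \<cdot> f \<oplus>\<^sub>m \<tau> \<cdot> g)"
      using eq[of "f \<oplus>\<^sub>m g"] f g t\<tau> by (simp add: comp_add)
    also have "\<dots> = ?t f \<odot>\<^sub>m \<eta> \<oplus>\<^sub>m ?t g \<odot>\<^sub>m \<eta>"
      using eq[OF f] eq[OF g] f g t\<tau> by (subst partial_trace_add) simp_all
    finally show "?t (f \<oplus>\<^sub>m g) \<odot>\<^sub>m \<eta> = (?t f + ?t g) \<odot>\<^sub>m \<eta>" by (simp add: scale_add_left)
  qed simp
  moreover have "?t (c \<odot>\<^sub>m f) = c * ?t f" if f: "src C f = \<alpha> \<boxtimes> Q" "tgt C f = \<beta> \<boxtimes> Q" for c f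
  proof (rule scale_cancel[of _ \<eta>])
    have "?t (c \<odot>\<^sub>m f) \<odot>\<^sub>m \<eta> = right_partial_trace C \<alpha> P Q (c \<odot>\<^sub>m (\<tau> \<cdot> f))"
      using eq[of "c \<odot>\<^sub>m f"] f t\<tau> by simp
    also have "\<dots> = c \<odot>\<^sub>m (?t f \<odot>\<^sub>m \<eta>)" using eq[OF f] f t\<tau> by (subst partial_trace_scale) simp_all
    finally show "?t (c \<odot>\<^sub>m f) \<odot>\<^sub>m \<eta> = (c * ?t f) \<odot>\<^sub>m \<eta>" by (simp add: scale_scale)
  qed simp
  ultimately show ?thesis by (simp add: linear_form_def in_Hom_iff)
qed

text \<open>The transpose \<open>\<alpha> \<rightarrow> V \<boxtimes> Q\<^sup>\<star>\<close> of \<open>f\<close> is monic, so \<open>\<eta>\<close> extends along it to some \<open>h: V \<boxtimes> Q\<^sup>\<star> \<rightarrow> P\<close>. If \<open>g\<close> is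
  the transpose of \<open>h\<close>, then \<open>tr (g f) = \<eta>\<close>, so the scalar of \<open>tr (g f \<sigma>)\<close> is \<open>1\<close>, as
  \<open>tr (g f \<sigma>) \<eta> = tr (g f)\<close>. Hence \<open>\<epsilon> tr (g f \<sigma>) = \<epsilon>\<close>, which says that \<open>(\<epsilon> \<boxtimes> Q) g\<close> has trace \<open>1\<close>
  against \<open>f\<close>.\<close>

lemma trace_separates_right:
  assumes Q: "projective C Q" and f: "src C f = \<alpha> \<boxtimes> Q" "f \<noteq> \<zero>\<^sub>m (\<alpha> \<boxtimes> Q) (tgt C f)"
  obtains g where "src C g = tgt C f" "tgt C g = \<beta> \<boxtimes> Q" "associated_trace C P \<alpha> \<beta> \<eta> \<epsilon> Q (g \<cdot> f) = 1"
proof -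
  interpret T: exact_pairing C "Q\<^sup>\<star>" Q "coevt Q" "evt Q" by (rule pairing_dual_tilde)
  interpret D: exact_pairing C Q "Q\<^sup>\<star>" "coev Q" "ev Q" by (rule pairing_dual)
  obtain \<sigma> \<tau> where \<sigma>: "left_inverse_at C P \<alpha> \<eta> Q \<sigma>" and \<tau>: "right_inverse_at C P \<beta> \<epsilon> Q \<tau>"
    by (rule exists_inverses[OF Q])
  have t\<sigma>: "src C \<sigma> = P \<boxtimes> Q" "tgt C \<sigma> = \<alpha> \<boxtimes> Q" "\<sigma> \<cdot> (\<eta> \<boxtimes>\<^sub>m \<iota> Q) = \<iota> (\<alpha> \<boxtimes> Q)"
    using \<sigma> by (simp_all add: left_inverse_at_def in_Hom_iff)
  let ?f = "D.curry_right \<alpha> f"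
  have tf: "src C ?f = \<alpha>" "tgt C ?f = tgt C f \<boxtimes> Q\<^sup>\<star>" using f by simp_all
  have "?f \<noteq> \<zero>\<^sub>m \<alpha> (tgt C f \<boxtimes> Q\<^sup>\<star>)"
  proof
    assume "?f = \<zero>\<^sub>m \<alpha> (tgt C f \<boxtimes> Q\<^sup>\<star>)"
    hence "f = D.uncurry_right (tgt C f) (\<zero>\<^sub>m \<alpha> (tgt C f \<boxtimes> Q\<^sup>\<star>))"
      using D.uncurry_curry_right[OF f(1)] by simp
    thus False using f by (simp add: D.uncurry_right_def)
  qed
  hence "monic C ?f" using tf simple_\<alpha> by (intro monic_from_simple) simp_all
  from projective_imp_injective[OF projective_P this, of \<eta>] tf
  obtain h where h: "src C h = tgt C f \<boxtimes> Q\<^sup>\<star>" "tgt C h = P" "h \<cdot> ?f = \<eta>" by auto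
  define g where "g = T.curry_right (tgt C f) h"
  have tg: "src C g = tgt C f" "tgt C g = P \<boxtimes> Q" using h unfolding g_def by simp_all
  have "T.uncurry_right P g = h"
    unfolding g_def using T.uncurry_curry_right[OF h(1)] h(2) by simp
  hence tr: "right_partial_trace C \<alpha> P Q (g \<cdot> f) = \<eta>"
    using partial_trace_comp[OF f(1), of g P] tg h by simp
  let ?e = "right_partial_trace C P P Q (g \<cdot> f \<cdot> \<sigma>)"
  have te: "src C ?e = P" "tgt C ?e = P" using tg f t\<sigma> by simp_all
  have "?e \<cdot> \<eta> = right_partial_trace C \<alpha> P Q ((g \<cdot> f \<cdot> \<sigma>) \<cdot> (\<eta> \<boxtimes>\<^sub>m \<iota> Q))"
    using partial_trace_pre[of "g \<cdot> f \<cdot> \<sigma>" P Q P \<eta>] tg f t\<sigma> by simp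
  also have "(g \<cdot> f \<cdot> \<sigma>) \<cdot> (\<eta> \<boxtimes>\<^sub>m \<iota> Q) = g \<cdot> f" using tg f t\<sigma> by (simp add: assoc)
  finally have e\<eta>: "?e \<cdot> \<eta> = \<eta>" using tr by simp
  obtain c where c: "\<epsilon> \<cdot> ?e = c \<odot>\<^sub>m \<epsilon>" "?e \<cdot> \<eta> = c \<odot>\<^sub>m \<eta>" by (rule End_acts_by_scalar[OF te])
  have "c = 1" by (rule scale_cancel[of _ \<eta>]) (use c(2) e\<eta> in simp_all)
  let ?g = "(\<epsilon> \<boxtimes>\<^sub>m \<iota> Q) \<cdot> g"
  have tg': "src C ?g = tgt C f" "tgt C ?g = \<beta> \<boxtimes> Q" using tg by simp_all
  have "right_partial_trace C P \<beta> Q ((?g \<cdot> f) \<cdot> \<sigma>) = \<epsilon> \<cdot> ?e"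
    using partial_trace_post[of "g \<cdot> f \<cdot> \<sigma>" P Q P \<epsilon>] tg f t\<sigma> by (simp add: assoc)
  hence "associated_trace C P \<alpha> \<beta> \<eta> \<epsilon> Q (?g \<cdot> f) \<odot>\<^sub>m \<epsilon> = 1 \<odot>\<^sub>m \<epsilon>"
    using associated_trace_eq(2)[OF \<sigma> \<tau>, of "?g \<cdot> f"] tg' f c(1) \<open>c = 1\<close> by simp
  hence "associated_trace C P \<alpha> \<beta> \<eta> \<epsilon> Q (?g \<cdot> f) = 1" by (rule scale_cancel) simp
  thus thesis using that tg' by blast
qed

text \<open>Dual to the preceding lemma: the transpose \<open>V \<boxtimes> Q\<^sup>\<star> \<rightarrow> \<beta>\<close> of \<open>g\<close> is epic, so \<open>\<epsilon>\<close> lifts along it to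
  some \<open>h: P \<rightarrow> V \<boxtimes> Q\<^sup>\<star>\<close>, with transpose \<open>f: P \<boxtimes> Q \<rightarrow> V\<close>; then \<open>f (\<eta> \<boxtimes> Q)\<close> has trace \<open>1\<close> against \<open>g\<close>.\<close>

lemma trace_separates_left:
  assumes Q: "projective C Q" and g: "tgt C g = \<beta> \<boxtimes> Q" "g \<noteq> \<zero>\<^sub>m (src C g) (\<beta> \<boxtimes> Q)"
  obtains f where "src C f = \<alpha> \<boxtimes> Q" "tgt C f = src C g" "associated_trace C P \<alpha> \<beta> \<eta> \<epsilon> Q (g \<cdot> f) = 1"
proof -
  interpret T: exact_pairing C "Q\<^sup>\<star>" Q "coevt Q" "evt Q" by (rule pairing_dual_tilde)
  interpret D: exact_pairing C Q "Q\<^sup>\<star>" "coev Q" "ev Q" by (rule pairing_dual)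
  obtain \<sigma> \<tau> where \<sigma>: "left_inverse_at C P \<alpha> \<eta> Q \<sigma>" and \<tau>: "right_inverse_at C P \<beta> \<epsilon> Q \<tau>"
    by (rule exists_inverses[OF Q])
  have t\<tau>: "src C \<tau> = \<beta> \<boxtimes> Q" "tgt C \<tau> = P \<boxtimes> Q" "(\<epsilon> \<boxtimes>\<^sub>m \<iota> Q) \<cdot> \<tau> = \<iota> (\<beta> \<boxtimes> Q)"
    using \<tau> by (simp_all add: right_inverse_at_def in_Hom_iff)
  let ?g = "T.uncurry_right \<beta> g"
  have tg: "src C ?g = src C g \<boxtimes> Q\<^sup>\<star>" "tgt C ?g = \<beta>" using g by simp_all
  have "?g \<noteq> \<zero>\<^sub>m (src C g \<boxtimes> Q\<^sup>\<star>) \<beta>"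
  proof
    assume "?g = \<zero>\<^sub>m (src C g \<boxtimes> Q\<^sup>\<star>) \<beta>"
    hence "g = T.curry_right (src C g) (\<zero>\<^sub>m (src C g \<boxtimes> Q\<^sup>\<star>) \<beta>)"
      using T.curry_uncurry_right[OF g(1)] by simp
    thus False using g by (simp add: T.curry_right_def)
  qed
  hence "epic C ?g" using tg simple_\<beta> by (intro epic_to_simple) simp_all
  from projective_lift[OF projective_P this, of \<epsilon>] tg
  obtain h where h: "src C h = P" "tgt C h = src C g \<boxtimes> Q\<^sup>\<star>" "?g \<cdot> h = \<epsilon>" by auto
  define f where "f = D.uncurry_right (src C g) h"
  have tf: "src C f = P \<boxtimes> Q" "tgt C f = src C g" using h unfolding f_def by simp_all
  have "D.curry_right P f = h"
    unfolding f_def using D.curry_uncurry_right[OF h(2)] h(1) by simp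
  hence tr: "right_partial_trace C P \<beta> Q (g \<cdot> f) = \<epsilon>"
    using partial_trace_comp[OF tf(1), of g \<beta>] tf g h by simp
  let ?e = "right_partial_trace C P P Q (\<tau> \<cdot> g \<cdot> f)"
  have te: "src C ?e = P" "tgt C ?e = P" using tf g t\<tau> by simp_all
  have "\<epsilon> \<cdot> ?e = right_partial_trace C P \<beta> Q ((\<epsilon> \<boxtimes>\<^sub>m \<iota> Q) \<cdot> (\<tau> \<cdot> g \<cdot> f))"
    using partial_trace_post[of "\<tau> \<cdot> g \<cdot> f" P Q P \<epsilon>] tf g t\<tau> by simp
  also have "(\<epsilon> \<boxtimes>\<^sub>m \<iota> Q) \<cdot> (\<tau> \<cdot> g \<cdot> f) = g \<cdot> f" using tf g t\<tau> by (simp add: assoc[symmetric])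
  finally have \<epsilon>e: "\<epsilon> \<cdot> ?e = \<epsilon>" using tr by simp
  obtain c where c: "\<epsilon> \<cdot> ?e = c \<odot>\<^sub>m \<epsilon>" "?e \<cdot> \<eta> = c \<odot>\<^sub>m \<eta>" by (rule End_acts_by_scalar[OF te])
  have "c = 1" by (rule scale_cancel[of _ \<epsilon>]) (use c(1) \<epsilon>e in simp_all)
  let ?f = "f \<cdot> (\<eta> \<boxtimes>\<^sub>m \<iota> Q)"
  have tf': "src C ?f = \<alpha> \<boxtimes> Q" "tgt C ?f = src C g" using tf by simp_all
  have "right_partial_trace C \<alpha> P Q (\<tau> \<cdot> (g \<cdot> ?f)) = ?e \<cdot> \<eta>"
    using partial_trace_pre[of "\<tau> \<cdot> g \<cdot> f" P Q P \<eta>] tf g t\<tau> by (simp add: assoc)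
  hence "associated_trace C P \<alpha> \<beta> \<eta> \<epsilon> Q (g \<cdot> ?f) \<odot>\<^sub>m \<eta> = 1 \<odot>\<^sub>m \<eta>"
    using associated_trace_eq(1)[OF \<sigma> \<tau>, of "g \<cdot> ?f"] tf' g c(2) \<open>c = 1\<close> by simp
  hence "associated_trace C P \<alpha> \<beta> \<eta> \<epsilon> Q (g \<cdot> ?f) = 1" by (rule scale_cancel) simp
  thus thesis using that tf' by blast
qed

lemma trace_pairing_nondegenerate:
  assumes Q: "projective C Q"
  shows "nondegenerate_pairing (Hom_module C V (\<beta> \<boxtimes> Q)) (Hom_module C (\<alpha> \<boxtimes> Q) V)
    (\<lambda>g f. associated_trace C P \<alpha> \<beta> \<eta> \<epsilon> Q (g \<cdot> f))"
  unfolding nondegenerate_pairing_def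
proof (intro conjI ballI impI)
  let ?t = "associated_trace C P \<alpha> \<beta> \<eta> \<epsilon> Q"
  have add: "?t (a \<oplus>\<^sub>m b) = ?t a + ?t b"
    if "src C a = \<alpha> \<boxtimes> Q" "tgt C a = \<beta> \<boxtimes> Q" "src C b = \<alpha> \<boxtimes> Q" "tgt C b = \<beta> \<boxtimes> Q" for a b
    using associated_trace_linear[OF Q] that by (simp add: linear_form_def in_Hom_iff)
  have scale: "?t (c \<odot>\<^sub>m a) = c * ?t a" if "src C a = \<alpha> \<boxtimes> Q" "tgt C a = \<beta> \<boxtimes> Q" for a c
    using associated_trace_linear[OF Q] that by (simp add: linear_form_def in_Hom_iff)
  note lin = add scale
  {
    fix f assume "f \<in> carrier (Hom_module C (\<alpha> \<boxtimes> Q) V)"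
    hence "src C f = \<alpha> \<boxtimes> Q" "tgt C f = V" by (simp_all add: in_Hom_iff)
    thus "linear_form (Hom_module C V (\<beta> \<boxtimes> Q)) (\<lambda>g. ?t (g \<cdot> f))"
      unfolding linear_form_def using lin by (simp add: in_Hom_iff add_comp)
  next
    fix g assume "g \<in> carrier (Hom_module C V (\<beta> \<boxtimes> Q))"
    hence "src C g = V" "tgt C g = \<beta> \<boxtimes> Q" by (simp_all add: in_Hom_iff)
    thus "linear_form (Hom_module C (\<alpha> \<boxtimes> Q) V) (\<lambda>f. ?t (g \<cdot> f))"
      unfolding linear_form_def using lin by (simp add: in_Hom_iff comp_add)
  next
    fix g assume g: "g \<in> carrier (Hom_module C V (\<beta> \<boxtimes> Q))"
      "\<forall>f\<in>carrier (Hom_module C (\<alpha> \<boxtimes> Q) V). ?t (g \<cdot> f) = 0"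
    show "g = \<zero>\<^bsub>Hom_module C V (\<beta> \<boxtimes> Q)\<^esub>"
    proof (rule ccontr)
      assume ne: "g \<noteq> \<zero>\<^bsub>Hom_module C V (\<beta> \<boxtimes> Q)\<^esub>"
      have tg: "src C g = V" "tgt C g = \<beta> \<boxtimes> Q" using g(1) by (simp_all add: in_Hom_iff)
      have "g \<noteq> \<zero>\<^sub>m (src C g) (\<beta> \<boxtimes> Q)" using ne tg by simp
      then obtain f where "src C f = \<alpha> \<boxtimes> Q" "tgt C f = src C g" "?t (g \<cdot> f) = 1"
        using trace_separates_left[OF Q tg(2)] by blast
      thus False using g(2) tg by (simp add: in_Hom_iff)
    qed
  next
    fix f assume f: "f \<in> carrier (Hom_module C (\<alpha> \<boxtimes> Q) V)"
      "\<forall>g\<in>carrier (Hom_module C V (\<beta> \<boxtimes> Q)). ?t (g \<cdot> f) = 0"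
    show "f = \<zero>\<^bsub>Hom_module C (\<alpha> \<boxtimes> Q) V\<^esub>"
    proof (rule ccontr)
      assume ne: "f \<noteq> \<zero>\<^bsub>Hom_module C (\<alpha> \<boxtimes> Q) V\<^esub>"
      have tf: "src C f = \<alpha> \<boxtimes> Q" "tgt C f = V" using f(1) by (simp_all add: in_Hom_iff)
      have "f \<noteq> \<zero>\<^sub>m (\<alpha> \<boxtimes> Q) (tgt C f)" using ne tf by simp
      then obtain g where "src C g = tgt C f" "tgt C g = \<beta> \<boxtimes> Q" "?t (g \<cdot> f) = 1"
        using trace_separates_right[OF Q tf(1)] by blast
      thus False using f(2) tf by (simp add: in_Hom_iff)
    qed
  }
qed

end

theorem theorem5p5:
  fixes C :: "('o, 'm, 'k::alg_closed_field) tensor_data" (structure)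
    and S P \<alpha> \<beta> :: 'o and p \<eta> \<epsilon> :: 'm
  assumes "pivotal_tensor_category C"
    and "abelian_category C"
    and "locally_finite C"
    and "simple_object C S"
    and "projective_cover C S P p"
    and "simple_object C \<beta>" and "\<epsilon> \<in> Hom C P \<beta>" and "epic C \<epsilon>"
    and "simple_object C \<alpha>" and "\<eta> \<in> Hom C \<alpha> P" and "monic C \<eta>"
  shows "trace_tuple C P \<alpha> \<beta> \<eta> \<epsilon> \<and>
    {Q. projective C Q} \<subseteq> trace_ideal C P \<alpha> \<beta> \<eta> \<epsilon> \<and>
    (\<forall>Q V. projective C Q \<longrightarrow>
      nondegenerate_pairing (Hom_module C V (\<beta> \<boxtimes> Q)) (Hom_module C (\<alpha> \<boxtimes> Q) V)
        (\<lambda>g f. associated_trace C P \<alpha> \<beta> \<eta> \<epsilon> Q (g \<cdot> f)))"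
proof -
  interpret pivotal_tensor_category C by fact
  interpret simple_projective_cover C S P \<alpha> \<beta> p \<eta> \<epsilon>
    using assms by unfold_locales (simp_all add: locally_finite_def)
  show ?thesis using is_trace_tuple projective_in_trace_ideal trace_pairing_nondegenerate by blast
qed

end
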